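(* Consider Bernoulli bond or site percolation on a graph $G\in\mathcal S$, and let $c(p)=\lim_{n\to\infty}\Pr_p(|C_o|=n)^{1/n}$. Then $c(p)$ is a continuous function of $p\in(0,1)$.
   Context: The class $\mathcal S$: (a) quasi-transitive planar lattices: 2-connected, locally finite, connected graphs embedded in $\mathbb R^2$ that are preserved by translations by two linearly independent vectors and have finitely many vertex orbits under these translations; (b) $\mathbb Z^d$, $d\ge2$; (c) $\mathbb T^d$, $d\ge2$: $\mathbb Z^d$ together with all edges $xy$ such that $y_i-x_i=1$ for exactly two coordinates $i$ and $y_i=x_i$ otherwise. $C_o$ is the cluster of a fixed vertex $o$ (component of $o$ in the occupied subgraph), and $|C_o|$ is its size (number of edges in bond percolation, number of vertices in site percolation). It is known that the limit defining $c(p)$ exists for every $p\in(0,1)$. *)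

theory Defs
  imports "HOL-Probability.Probability"
begin

section \<open>Graphs\<close>

text \<open>A simple graph: vertex set V, edges are two-element subsets of V.\<close>
definition simple_graph :: "'v set \<Rightarrow> 'v set set \<Rightarrow> bool" where
  "simple_graph V E \<longleftrightarrow> (\<forall>e\<in>E. \<exists>x y. x \<in> V \<and> y \<in> V \<and> x \<noteq> y \<and> e = {x, y})"

definition adj_rel :: "'v set set \<Rightarrow> ('v \<times> 'v) set" where
  "adj_rel E = {(x, y). {x, y} \<in> E}"

definition graph_connected :: "'v set \<Rightarrow> 'v set set \<Rightarrow> bool" where
  "graph_connected V E \<longleftrightarrow> (\<forall>x\<in>V. \<forall>y\<in>V. (x, y) \<in> (adj_rel E)\<^sup>*)"

definition locally_finite :: "'v set \<Rightarrow> 'v set set \<Rightarrow> bool" where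
  "locally_finite V E \<longleftrightarrow> (\<forall>v\<in>V. finite {e \<in> E. v \<in> e})"

text \<open>2-connected: connected, at least 3 vertices, and stays connected after
  deleting any single vertex (with its incident edges).\<close>
definition two_connected :: "'v set \<Rightarrow> 'v set set \<Rightarrow> bool" where
  "two_connected V E \<longleftrightarrow> graph_connected V E \<and> \<not> (finite V \<and> card V < 3) \<and>
     (\<forall>v\<in>V. graph_connected (V - {v}) {e \<in> E. v \<notin> e})"

definition graph_iso :: "('v \<Rightarrow> 'w) \<Rightarrow> 'v set \<Rightarrow> 'v set set \<Rightarrow> 'w set \<Rightarrow> 'w set set \<Rightarrow> bool" where
  "graph_iso f V E V' E' \<longleftrightarrow> bij_betw f V V' \<and>
     (\<forall>x\<in>V. \<forall>y\<in>V. {x, y} \<in> E \<longleftrightarrow> {f x, f y} \<in> E')"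

section \<open>Quasi-transitive planar lattices\<close>

definition translate2 :: "real^2 \<Rightarrow> real^2 \<Rightarrow> real^2" where
  "translate2 t v = v + t"

text \<open>A plane embedding of a simple graph with vertex set V in the plane:
  each edge is drawn as an arc between its endpoints, meeting V only at its
  endpoints, and two distinct edges meet only at common endpoints.\<close>
definition plane_drawing :: "(real^2) set \<Rightarrow> (real^2) set set \<Rightarrow> ((real^2) set \<Rightarrow> real \<Rightarrow> real^2) \<Rightarrow> bool" where
  "plane_drawing V E \<gamma> \<longleftrightarrow>
     (\<forall>e\<in>E. arc (\<gamma> e) \<and> {pathstart (\<gamma> e), pathfinish (\<gamma> e)} = e \<and> path_image (\<gamma> e) \<inter> V = e) \<and>
     (\<forall>e\<in>E. \<forall>e'\<in>E. e \<noteq> e' \<longrightarrow> path_image (\<gamma> e) \<inter> path_image (\<gamma> e') \<subseteq> e \<inter> e')"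

text \<open>The embedded graph is preserved by translation by t.\<close>
definition preserved_by :: "(real^2) set \<Rightarrow> (real^2) set set \<Rightarrow> ((real^2) set \<Rightarrow> real \<Rightarrow> real^2) \<Rightarrow> real^2 \<Rightarrow> bool" where
  "preserved_by V E \<gamma> t \<longleftrightarrow>
     translate2 t ` V = V \<and> (\<lambda>e. translate2 t ` e) ` E = E \<and>
     (\<forall>e\<in>E. path_image (\<gamma> (translate2 t ` e)) = translate2 t ` path_image (\<gamma> e))"

definition planar_lattice :: "(real^2) set \<Rightarrow> (real^2) set set \<Rightarrow> bool" where
  "planar_lattice V E \<longleftrightarrow>
     simple_graph V E \<and> two_connected V E \<and> locally_finite V E \<and> graph_connected V E \<and>
     (\<exists>\<gamma> a b. plane_drawing V E \<gamma> \<and>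
        a $ 1 * b $ 2 - a $ 2 * b $ 1 \<noteq> 0 \<and>
        preserved_by V E \<gamma> a \<and> preserved_by V E \<gamma> b \<and>
        finite (V // {(x, y). x \<in> V \<and> y \<in> V \<and>
                   (\<exists>m n :: int. y = x + of_int m *\<^sub>R a + of_int n *\<^sub>R b)}))"

section \<open>Hypercubic lattice Z^d and the lattice T^d\<close>

definition Zd_V :: "nat \<Rightarrow> int list set" where
  "Zd_V d = {x. length x = d}"

definition Zd_E :: "nat \<Rightarrow> int list set set" where
  "Zd_E d = {{x, y} | x y. x \<in> Zd_V d \<and> y \<in> Zd_V d \<and>
     (\<exists>i<d. \<bar>y ! i - x ! i\<bar> = 1 \<and> (\<forall>j<d. j \<noteq> i \<longrightarrow> y ! j = x ! j))}"

definition Td_E :: "nat \<Rightarrow> int list set set" where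
  "Td_E d = Zd_E d \<union> {{x, y} | x y. x \<in> Zd_V d \<and> y \<in> Zd_V d \<and>
     (\<exists>i<d. \<exists>j<d. i \<noteq> j \<and> y ! i - x ! i = 1 \<and> y ! j - x ! j = 1 \<and>
        (\<forall>k<d. k \<noteq> i \<and> k \<noteq> j \<longrightarrow> y ! k = x ! k))}"

text \<open>The class S (up to graph isomorphism).\<close>
definition in_class_S :: "'v set \<Rightarrow> 'v set set \<Rightarrow> bool" where
  "in_class_S V E \<longleftrightarrow> simple_graph V E \<and>
    ((\<exists>V' E' (f :: 'v \<Rightarrow> real^2). planar_lattice V' E' \<and> graph_iso f V E V' E') \<or>
     (\<exists>d\<ge>2. \<exists>f. graph_iso f V E (Zd_V d) (Zd_E d)) \<or>
     (\<exists>d\<ge>2. \<exists>f. graph_iso f V E (Zd_V d) (Td_E d)))"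

section \<open>Bernoulli percolation\<close>

text \<open>Bond percolation: configurations \<omega> on E (True = open).\<close>
definition bond_space :: "'v set set \<Rightarrow> real \<Rightarrow> ('v set \<Rightarrow> bool) measure" where
  "bond_space E p = PiM E (\<lambda>_. measure_pmf (bernoulli_pmf p))"

definition bond_cluster_vertices :: "'v set set \<Rightarrow> ('v set \<Rightarrow> bool) \<Rightarrow> 'v \<Rightarrow> 'v set" where
  "bond_cluster_vertices E \<omega> v0 = {y. (v0, y) \<in> {(a, b). {a, b} \<in> E \<and> \<omega> {a, b}}\<^sup>*}"

text \<open>Edges of the cluster of v0 (its size in bond percolation).\<close>
definition bond_cluster_edges :: "'v set set \<Rightarrow> ('v set \<Rightarrow> bool) \<Rightarrow> 'v \<Rightarrow> 'v set set" where
  "bond_cluster_edges E \<omega> v0 = {e \<in> E. \<omega> e \<and> e \<subseteq> bond_cluster_vertices E \<omega> v0}"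

definition bond_prob :: "'v set set \<Rightarrow> 'v \<Rightarrow> real \<Rightarrow> nat \<Rightarrow> real" where
  "bond_prob E v0 p n = measure (bond_space E p)
     {\<omega> \<in> space (bond_space E p). finite (bond_cluster_edges E \<omega> v0) \<and> card (bond_cluster_edges E \<omega> v0) = n}"

definition bond_c :: "'v set set \<Rightarrow> 'v \<Rightarrow> real \<Rightarrow> real" where
  "bond_c E v0 p = lim (\<lambda>n. root n (bond_prob E v0 p n))"

text \<open>Site percolation: configurations \<omega> on V (True = open/occupied).\<close>
definition site_space :: "'v set \<Rightarrow> real \<Rightarrow> ('v \<Rightarrow> bool) measure" where
  "site_space V p = PiM V (\<lambda>_. measure_pmf (bernoulli_pmf p))"

definition site_cluster :: "'v set set \<Rightarrow> ('v \<Rightarrow> bool) \<Rightarrow> 'v \<Rightarrow> 'v set" where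
  "site_cluster E \<omega> v0 = (if \<omega> v0 then {y. (v0, y) \<in> {(a, b). {a, b} \<in> E \<and> \<omega> a \<and> \<omega> b}\<^sup>*} else {})"

definition site_prob :: "'v set \<Rightarrow> 'v set set \<Rightarrow> 'v \<Rightarrow> real \<Rightarrow> nat \<Rightarrow> real" where
  "site_prob V E v0 p n = measure (site_space V p)
     {\<omega> \<in> space (site_space V p). finite (site_cluster E \<omega> v0) \<and> card (site_cluster E \<omega> v0) = n}"

definition site_c :: "'v set \<Rightarrow> 'v set set \<Rightarrow> 'v \<Rightarrow> real \<Rightarrow> real" where
  "site_c V E v0 p = lim (\<lambda>n. root n (site_prob V E v0 p n))"

end

theory Submission
  imports Defs "HOL-Real_Asymp.Real_Asymp"
begin

text \<open>
  Planarity plays no role: all that is used is that the graph is connected and locally finite, and that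
  a group of automorphisms acts on it freely with finitely many orbits, shifting a height function.
  Bond percolation is site percolation on the line graph, rooted at the star of the vertex, so both
  cases are about \<open>Q p n\<close>, the sum of \<open>p ^ n * (1 - p) ^ b\<close> over the animals \<open>C\<close> of size \<open>n\<close>
  that meet the root set, where \<open>b\<close> is the size of the vertex boundary of \<open>C\<close>.

  Since \<open>lim\<close> is arbitrary for divergent sequences, the existence of the limit has to be proved.
  Given animals \<open>C\<close> and \<open>D\<close>, translate \<open>D\<close> strictly above \<open>C\<close> so that its lowest point lies at
  bounded distance from the highest point of \<open>C\<close>, and open a path joining the two. The weight
  changes by a bounded factor. At most polynomially many pairs, with a bound depending on \<open>card D\<close>
  only, yield the same result, because \<open>D\<close> is essentially its top part. Thus \<open>Q p n * Q p m\<close> is at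
  most \<open>M m * (\<Sum>k\<le>K. Q p (n + m + k))\<close> with \<open>M\<close> polynomial, and a variant of Fekete's argument
  gives convergence. Continuity follows because \<open>b \<le> \<Delta> * n\<close>, whence changing \<open>p\<close> to \<open>q\<close> changes the
  weights at most by the \<open>n\<close>-th power of a factor that tends to 1.
\<close>

section \<open>Almost supermultiplicative sequences\<close>

text \<open>The limit is the supremum \<open>L\<close> of \<open>x m - y m\<close> over positive
  \<open>m\<close>: by \<open>ge\<close>, \<open>x n\<close> eventually exceeds every number below
  \<open>L\<close>, while \<open>x n \<le> L + y n\<close> with \<open>y n\<close> tending to 0
  bounds it from above.\<close>

lemma convergent_if_eventually_almost_ge:
  fixes x y :: "nat \<Rightarrow> real"
  assumes y: "y \<longlonglongrightarrow> 0" and y0: "\<And>m. 0 \<le> y m"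
    and ub: "\<And>n. x n \<le> B"
    and ge: "\<And>m \<epsilon>. 0 < m \<Longrightarrow> 0 < \<epsilon> \<Longrightarrow> eventually (\<lambda>n. x m - y m - \<epsilon> \<le> x n) sequentially"
  shows "convergent x"
proof -
  define L where "L = (SUP m\<in>{0<..}. x m - y m)"
  have bdd: "bdd_above ((\<lambda>m. x m - y m) ` {0<..})"
    by (rule bdd_aboveI[of _ B]) (use ub y0 in \<open>smt (verit) imageE\<close>)
  have "x \<longlonglongrightarrow> L"
  proof (rule LIMSEQ_I)
    fix r :: real assume r: "0 < r"
    have "\<exists>m\<in>{0<..}. L - r/2 < x m - y m"
      using r by (subst less_cSUP_iff[OF _ bdd, symmetric]) (auto simp: L_def)
    then obtain m where m: "0 < m" "L - r/2 < x m - y m" by auto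
    have "eventually (\<lambda>n. x m - y m - r/2 \<le> x n) sequentially" using ge m r by simp
    moreover have "eventually (\<lambda>n. y n < r) sequentially" using order_tendstoD(2)[OF y r] .
    moreover have "eventually (\<lambda>n. 0 < n) sequentially" by (rule eventually_gt_at_top)
    ultimately have "eventually (\<lambda>n. norm (x n - L) < r) sequentially"
    proof eventually_elim
      case (elim n)
      have "x n - y n \<le> L" unfolding L_def by (rule cSUP_upper[OF _ bdd]) (use elim in auto)
      with elim m show ?case by (auto simp: abs_if)
    qed
    then show "\<exists>no. \<forall>n\<ge>no. norm (x n - L) < r" by (simp add: eventually_sequentially)
  qed
  then show ?thesis by (rule convergentI)
qed

text \<open>Fekete's argument for \<open>ln (q n) / n\<close>. By \<open>glue\<close>, only some
  unknown one of the \<open>K + 1\<close> lengths \<open>n + m + k\<close> is sure to carry enough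
  mass, so multiples of \<open>m\<close> cannot be hit exactly. A greedy chain of gluings comes
  within \<open>m + K\<close> of the target \<open>N\<close>, and \<open>pad\<close> closes the gap
  at a cost polynomial in \<open>N\<close> for fixed \<open>m\<close>.\<close>

lemma root_convergent_if_supermultiplicative:
  fixes q M :: "nat \<Rightarrow> real" and c :: real and K :: nat
  assumes pos: "\<And>n. 0 < n \<Longrightarrow> 0 < q n" and le1: "\<And>n. 0 < n \<Longrightarrow> q n \<le> 1"
    and M1: "\<And>m. 1 \<le> M m" and M: "(\<lambda>m. ln (M m) / real m) \<longlonglongrightarrow> 0"
    and glue: "\<And>n m. 0 < n \<Longrightarrow> 0 < m \<Longrightarrow> q n * q m \<le> M m * (\<Sum>k\<le>K. q (n + m + k))"
    and c: "0 < c" "c \<le> 1"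
    and pad: "\<And>n. 0 < n \<Longrightarrow> c * q n \<le> real (n + 1) * q (n + 1)"
  shows "convergent (\<lambda>n. root n (q n))"
proof -
  define x where "x n = ln (q n) / real n" for n
  define y where "y m = (ln (M m) + ln (real (K + 1))) / real m" for m
  \<comment> \<open>The factor by which one gluing with length \<open>m\<close> changes
    \<open>q\<close>, after pigeonholing over \<open>K + 1\<close> lengths. Both losses are
    collected in \<open>y\<close>, so that \<open>ln (\<delta> m) / m = x m - y m\<close>.\<close>
  define \<delta> where "\<delta> m = q m / (M m * real (K + 1))" for m
  have Mpos: "0 < M m" for m using M1[of m] by linarith
  have \<delta>pos: "0 < \<delta> m" and \<delta>1: "\<delta> m \<le> 1" if "0 < m" for m
  proof -
    show "0 < \<delta> m" using pos[OF that] Mpos by (simp add: \<delta>_def)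
    have "1 * 1 \<le> M m * real (K + 1)" by (intro mult_mono M1) (use Mpos[of m] in auto)
    then show "\<delta> m \<le> 1" using le1[OF that] Mpos by (simp add: \<delta>_def)
  qed
  have step: "\<exists>k\<le>K. \<delta> m * q n \<le> q (n + m + k)" if nm: "0 < n" "0 < m" for n m
  proof (rule ccontr)
    assume "\<not> ?thesis"
    then have "(\<Sum>k\<le>K. q (n + m + k)) < (\<Sum>k\<le>K. \<delta> m * q n)"
      by (intro sum_strict_mono) (auto simp: not_le[symmetric])
    then have "M m * (\<Sum>k\<le>K. q (n + m + k)) < M m * (real (K + 1) * (\<delta> m * q n))"
      using Mpos[of m] by (intro mult_strict_left_mono) (auto simp: algebra_simps)
    also have "\<dots> = (M m * real (K + 1) * \<delta> m) * q n" by (simp only: mult.assoc)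
    also have "M m * real (K + 1) * \<delta> m = q m" using Mpos[of m] by (simp add: \<delta>_def)
    finally show False using glue[OF nm] by (simp add: mult.commute)
  qed
  \<comment> \<open>Here \<open>j\<close> counts the gluings made since length 1. Each adds between
    \<open>m\<close> and \<open>m + K\<close>, whence \<open>j * m \<le> N'\<close> and a lag behind
    \<open>N\<close> of at most \<open>m + K\<close>.\<close>
  have chain: "\<exists>N' j. 0 < N' \<and> N' \<le> N \<and> N \<le> N' + (m + K) \<and> j * m \<le> N' \<and> q 1 * \<delta> m ^ j \<le> q N'"
    if m: "0 < m" and N: "1 \<le> N" for m N
    using N
  proof (induction N rule: dec_induct)
    case base
    show ?case by (rule exI[of _ 1], rule exI[of _ 0]) auto
  next
    case (step N)
    then obtain N' j where I: "0 < N'" "N' \<le> N" "N \<le> N' + (m + K)" "j * m \<le> N'" "q 1 * \<delta> m ^ j \<le> q N'"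
      by blast
    show ?case
    proof (cases "Suc N \<le> N' + (m + K)")
      case True
      with I show ?thesis by (intro exI[of _ N'] exI[of _ j]) auto
    next
      case False
      obtain k where k: "k \<le> K" "\<delta> m * q N' \<le> q (N' + m + k)" using \<open>0 < N'\<close> m \<open>\<And>n m. 0 < n \<Longrightarrow> 0 < m \<Longrightarrow> \<exists>k\<le>K. \<delta> m * q n \<le> q (n + m + k)\<close> by blast
      have "q 1 * \<delta> m ^ Suc j \<le> \<delta> m * q N'" using I(5) \<delta>pos[OF m] by (simp add: mult.commute mult.left_commute)
      with k I False m show ?thesis by (intro exI[of _ "N' + m + k"] exI[of _ "Suc j"]) auto
    qed
  qed
  \<comment> \<open>All lengths involved are at most \<open>N\<close>, so the single factor
    \<open>c / real (N + 1)\<close> serves every padding step.\<close>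
  have pad_iter: "(c / real (N + 1)) ^ i * q N' \<le> q (N' + i)" if "0 < N'" "N' + i \<le> N" for N N' i
    using that(2)
  proof (induction i)
    case (Suc i)
    let ?r = "c / real (N + 1)"
    have "?r ^ Suc i * q N' = ?r * (?r ^ i * q N')" by simp
    also have "\<dots> \<le> ?r * q (N' + i)" using Suc c by (intro mult_left_mono) auto
    also have "\<dots> \<le> c / real (N' + i + 1) * q (N' + i)"
      using Suc.prems c pos[of "N' + i"] \<open>0 < N'\<close> by (intro mult_right_mono divide_left_mono) auto
    also have "\<dots> \<le> q (N' + Suc i)" using pad[of "N' + i"] \<open>0 < N'\<close> by (simp add: field_simps)
    finally show ?case .
  qed simp
  have lower: "x m - y m + (ln (q 1) + real (m + K) * ln (c / real (N + 1))) / real N \<le> x N"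
    if m: "0 < m" and N: "1 \<le> N" for m N
  proof -
    define r where "r = c / real (N + 1)"
    obtain N' j where I: "0 < N'" "N' \<le> N" "N \<le> N' + (m + K)" "j * m \<le> N'" "q 1 * \<delta> m ^ j \<le> q N'"
      using chain[OF m N] by blast
    have r: "0 < r" "r \<le> 1" using c by (auto simp: r_def field_simps)
    have "r ^ (m + K) * (q 1 * \<delta> m ^ j) \<le> r ^ (N - N') * q N'"
      using I r pos[of 1] \<delta>pos[OF m] by (intro mult_mono power_decreasing) auto
    also have "\<dots> \<le> q N" using pad_iter[of N' "N - N'" N] I by (simp add: r_def)
    finally have "ln (r ^ (m + K) * (q 1 * \<delta> m ^ j)) \<le> ln (q N)"
      using r pos[of 1] \<delta>pos[OF m] N pos[of N] by (subst ln_le_cancel_iff) auto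
    then have A: "real (m + K) * ln r + ln (q 1) + real j * ln (\<delta> m) \<le> ln (q N)"
      using r pos[of 1] \<delta>pos[OF m] by (simp add: ln_mult_pos ln_realpow)
    \<comment> \<open>As \<open>ln (\<delta> m) \<le> 0\<close>, it is an upper bound on
      \<open>j\<close> that bounds \<open>real j * ln (\<delta> m)\<close> from below.\<close>
    have "real j * real m \<le> real N" using I by (metis of_nat_le_iff of_nat_mult order_trans)
    then have "real j \<le> real N / real m" using m by (simp add: field_simps)
    then have "real N / real m * ln (\<delta> m) \<le> real j * ln (\<delta> m)"
      using \<delta>pos[OF m] \<delta>1[OF m] by (intro mult_right_mono_neg) auto
    moreover have "ln (\<delta> m) = ln (q m) - (ln (M m) + ln (real (K + 1)))"
      using pos[OF m] Mpos[of m] by (simp add: \<delta>_def ln_div ln_mult)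
    then have xy: "x m - y m = ln (\<delta> m) / real m" by (simp add: x_def y_def diff_divide_distrib)
    have "real N * (x m - y m) = real N / real m * ln (\<delta> m)" unfolding xy by simp
    ultimately have "real N * (x m - y m) + (ln (q 1) + real (m + K) * ln r) \<le> ln (q N)"
      using A by linarith
    then have "(real N * (x m - y m) + (ln (q 1) + real (m + K) * ln r)) / real N \<le> x N"
      using N unfolding x_def by (intro divide_right_mono) auto
    then show ?thesis using N by (simp add: add_divide_distrib r_def)
  qed
  have "convergent x"
  proof (rule convergent_if_eventually_almost_ge)
    have "(\<lambda>m. ln (real (K + 1)) / real m) \<longlonglongrightarrow> 0" by (rule lim_const_over_n)
    from tendsto_add[OF M this] show "y \<longlonglongrightarrow> 0" by (simp add: y_def[abs_def] add_divide_distrib)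
    show "0 \<le> y m" for m using M1[of m] by (simp add: y_def)
    show "x n \<le> 0" for n
      using le1[of n] pos[of n] by (cases "n = 0") (auto simp: x_def divide_nonpos_nonneg)
    fix m :: nat and \<epsilon> :: real assume m: "0 < m" and \<epsilon>: "0 < \<epsilon>"
    \<comment> \<open>For fixed \<open>m\<close> the correction is of order
      \<open>ln N / N\<close>.\<close>
    have "((\<lambda>N. (ln (q 1) + real (m + K) * ln (c / real (N + 1))) / real N) \<longlongrightarrow> 0) at_top"
      using c by real_asymp
    then have "eventually (\<lambda>N. - \<epsilon> < (ln (q 1) + real (m + K) * ln (c / real (N + 1))) / real N) sequentially"
      using \<epsilon> by (intro order_tendstoD) auto
    then show "eventually (\<lambda>N. x m - y m - \<epsilon> \<le> x N) sequentially"
      using eventually_ge_at_top[of 1] by eventually_elim (use lower[OF m] in fastforce)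
  qed
  then obtain L where "x \<longlonglongrightarrow> L" by (auto simp: convergent_def)
  then have "(\<lambda>n. exp (x n)) \<longlonglongrightarrow> exp L" by (rule tendsto_exp)
  moreover have "eventually (\<lambda>n. exp (x n) = root n (q n)) sequentially"
    using eventually_gt_at_top[of 0]
  proof eventually_elim
    case (elim n)
    then show ?case using pos[of n]
      by (simp add: x_def root_powr_inverse powr_def field_simps)
  qed
  ultimately have "(\<lambda>n. root n (q n)) \<longlonglongrightarrow> exp L" by (rule Lim_transform_eventually)
  then show ?thesis by (rule convergentI)
qed

text \<open>The hypothesis, applied to \<open>p, q\<close> and to \<open>q, p\<close>, squeezes
  \<open>c q\<close> between \<open>c p * g p q\<close> and \<open>c p / g q p\<close>. Both tend to
  \<open>c p\<close> because \<open>g p p = 1\<close>.\<close>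

lemma ratio_continuous_on:
  fixes c :: "real \<Rightarrow> real"
  assumes ratio: "\<And>p q. p \<in> {0<..<1} \<Longrightarrow> q \<in> {0<..<1} \<Longrightarrow>
      c p * (q / p * min 1 ((1 - q) / (1 - p)) ^ \<Delta>) \<le> c q"
  shows "continuous_on {0<..<1} c"
  unfolding continuous_on_def
proof
  fix p :: real assume p: "p \<in> {0<..<1}"
  let ?F = "at p within {0<..<1}"
  define g where "g p q = q / p * min 1 ((1 - q) / (1 - p)) ^ \<Delta>" for p q :: real
  have g1: "((\<lambda>q. g p q) \<longlongrightarrow> g p p) ?F" and g2: "((\<lambda>q. g q p) \<longlongrightarrow> g p p) ?F"
    unfolding g_def by (intro tendsto_intros; use p in simp)+
  have gp: "g p p = 1" using p by (simp add: g_def)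
  have ev: "eventually (\<lambda>q. q \<in> {0<..<1}) ?F" by (simp add: eventually_at_filter)
  show "(c \<longlongrightarrow> c p) ?F"
  proof (rule tendsto_sandwich)
    show "eventually (\<lambda>q. c p * g p q \<le> c q) ?F"
      using ev by eventually_elim (use ratio p in \<open>auto simp: g_def\<close>)
    show "eventually (\<lambda>q. c q \<le> c p / g q p) ?F"
      using ev
    proof eventually_elim
      case (elim q)
      then have "0 < g q p" using p by (auto simp: g_def)
      moreover have "c q * g q p \<le> c p" using ratio[OF elim p] by (simp add: g_def)
      ultimately show ?case by (simp add: pos_le_divide_eq)
    qed
    show "((\<lambda>q. c p * g p q) \<longlongrightarrow> c p) ?F" using tendsto_mult[OF tendsto_const g1, of "c p"] gp by simp
    show "((\<lambda>q. c p / g q p) \<longlongrightarrow> c p) ?F" using tendsto_divide[OF tendsto_const g2, of "c p"] gp by simp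
  qed
qed

section \<open>Periodic graphs\<close>

text \<open>The laws for \<open>\<Gamma>\<close> are stated only on \<open>V\<close>, so maps that
  are arbitrary elsewhere, such as conjugates by an inverse function, can serve as group elements.
  The relation \<open>adj\<close> may be reflexive, as intersection of edges is.\<close>

locale periodic_graph =
  fixes V :: "'a set" and adj :: "'a \<Rightarrow> 'a \<Rightarrow> bool" and \<Gamma> :: "('a \<Rightarrow> 'a) set" and h :: "'a \<Rightarrow> real"
  assumes adj_sym: "adj u v \<Longrightarrow> adj v u"
    and connected: "u \<in> V \<Longrightarrow> v \<in> V \<Longrightarrow> (u, v) \<in> {(x, y). x \<in> V \<and> y \<in> V \<and> adj x y}\<^sup>*"
    and finite_nbrs: "u \<in> V \<Longrightarrow> finite {v \<in> V. adj u v}"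
    and bij: "f \<in> \<Gamma> \<Longrightarrow> bij_betw f V V"
    and adj_iff: "f \<in> \<Gamma> \<Longrightarrow> u \<in> V \<Longrightarrow> v \<in> V \<Longrightarrow> adj (f u) (f v) \<longleftrightarrow> adj u v"
    and comp: "f \<in> \<Gamma> \<Longrightarrow> g \<in> \<Gamma> \<Longrightarrow> \<exists>k\<in>\<Gamma>. \<forall>v\<in>V. k v = f (g v)"
    and left_inverse: "f \<in> \<Gamma> \<Longrightarrow> \<exists>g\<in>\<Gamma>. \<forall>v\<in>V. g (f v) = v"
    and free: "f \<in> \<Gamma> \<Longrightarrow> g \<in> \<Gamma> \<Longrightarrow> u \<in> V \<Longrightarrow> f u = g u \<Longrightarrow> v \<in> V \<Longrightarrow> f v = g v"
    and height: "f \<in> \<Gamma> \<Longrightarrow> \<exists>c. \<forall>v\<in>V. h (f v) = h v + c"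
    and ascent: "\<exists>f\<in>\<Gamma>. \<exists>c>0. \<forall>v\<in>V. h (f v) = h v + c"
    and finite_orbits: "\<exists>F. finite F \<and> F \<subseteq> V \<and> (\<forall>v\<in>V. \<exists>f\<in>\<Gamma>. \<exists>r\<in>F. v = f r)"
begin

section \<open>Balls, linked sets, boundaries and weights\<close>

definition edges :: "('a \<times> 'a) set" where
  "edges = {(x, y). x \<in> V \<and> y \<in> V \<and> adj x y}"

definition nbrs :: "'a \<Rightarrow> 'a set" where
  "nbrs u = {v \<in> V. adj u v}"

text \<open>The ball of radius \<open>k\<close> about \<open>y\<close>: the reflexive closure makes
  the \<open>k\<close>-th power count paths of length at most \<open>k\<close>.\<close>

definition near :: "nat \<Rightarrow> 'a \<Rightarrow> 'a set" where
  "near k y = {x. (x, y) \<in> (edges\<^sup>=) ^^ k}"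

definition links :: "'a set \<Rightarrow> ('a \<times> 'a) set" where
  "links C = {(u, v). u \<in> C \<and> v \<in> C \<and> adj u v}"

definition linked :: "'a set \<Rightarrow> bool" where
  "linked C \<longleftrightarrow> (\<forall>x\<in>C. \<forall>y\<in>C. (x, y) \<in> (links C)\<^sup>*)"

definition boundary :: "'a set \<Rightarrow> 'a set" where
  "boundary C = {v \<in> V - C. \<exists>u\<in>C. adj u v}"

text \<open>For an animal \<open>C\<close> this is the probability that \<open>C\<close> is open and
  its outer boundary closed, that is, that the cluster of the roots equals \<open>C\<close>.\<close>

definition weight :: "real \<Rightarrow> 'a set \<Rightarrow> real" where
  "weight p C = p ^ card C * (1 - p) ^ card (boundary C)"

lemma maps_to: "f \<in> \<Gamma> \<Longrightarrow> v \<in> V \<Longrightarrow> f v \<in> V"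
  by (rule bij_betw_apply[OF bij])

lemma inj: "f \<in> \<Gamma> \<Longrightarrow> inj_on f V"
  by (rule bij_betw_imp_inj_on[OF bij])

lemma surj: "f \<in> \<Gamma> \<Longrightarrow> f ` V = V"
  by (rule bij_betw_imp_surj_on[OF bij])

lemma two_sided_inverse:
  assumes "f \<in> \<Gamma>"
  shows "\<exists>g\<in>\<Gamma>. \<forall>v\<in>V. g (f v) = v \<and> f (g v) = v"
proof -
  obtain g where g: "g \<in> \<Gamma>" "\<forall>v\<in>V. g (f v) = v" using left_inverse[OF assms] by blast
  have "f (g v) = v" if "v \<in> V" for v
  proof -
    obtain u where "u \<in> V" "v = f u" using surj[OF assms] \<open>v \<in> V\<close> by blast
    then show ?thesis using g(2) by simp
  qed
  with g show ?thesis by blast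
qed

lemma nbrs_subset: "nbrs u \<subseteq> V"
  by (auto simp: nbrs_def)

lemma finite_nbrs': "u \<in> V \<Longrightarrow> finite (nbrs u)"
  unfolding nbrs_def by (rule finite_nbrs)

lemma nbrs_image:
  assumes "f \<in> \<Gamma>" "u \<in> V"
  shows "nbrs (f u) = f ` nbrs u"
proof
  show "nbrs (f u) \<subseteq> f ` nbrs u"
  proof
    fix w assume w: "w \<in> nbrs (f u)"
    then have "w \<in> f ` V" using surj[OF assms(1)] by (auto simp: nbrs_def)
    then obtain v where "v \<in> V" "w = f v" by blast
    then show "w \<in> f ` nbrs u" using w adj_iff assms by (auto simp: nbrs_def)
  qed
  show "f ` nbrs u \<subseteq> nbrs (f u)"
    using maps_to adj_iff assms by (auto simp: nbrs_def)
qed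

text \<open>Automorphisms carry neighbourhoods to neighbourhoods, so every degree is bounded by that
  of one of finitely many orbit representatives.\<close>

lemma degree_bound: "\<exists>\<Delta>. \<forall>v\<in>V. card (nbrs v) \<le> \<Delta>"
proof -
  obtain F where F: "finite F" "F \<subseteq> V" "\<forall>v\<in>V. \<exists>f\<in>\<Gamma>. \<exists>r\<in>F. v = f r"
    using finite_orbits by blast
  have "card (nbrs v) \<le> (\<Sum>r\<in>F. card (nbrs r))" if v: "v \<in> V" for v
  proof -
    obtain f r where fr: "f \<in> \<Gamma>" "r \<in> F" "v = f r" using bspec[OF F(3) v] by blast
    then have "r \<in> V" using F(2) by blast
    then have "card (nbrs v) \<le> card (nbrs r)"
      using fr nbrs_image finite_nbrs' by (simp add: card_image_le)
    also have "\<dots> \<le> (\<Sum>r\<in>F. card (nbrs r))" using F fr by (intro member_le_sum) auto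
    finally show ?thesis .
  qed
  then show ?thesis by blast
qed

lemma relpow_reflcl_mono: "k \<le> l \<Longrightarrow> (x, y) \<in> (R\<^sup>=) ^^ k \<Longrightarrow> (x, y) \<in> (R\<^sup>=) ^^ l"
  by (induction l rule: dec_induct) auto

lemma relpow_subset: "R \<subseteq> S \<Longrightarrow> R ^^ k \<subseteq> S ^^ k" for R S :: "('b \<times> 'b) set"
  by (induction k) auto

lemma near_Suc:
  assumes "y \<in> V" "near k y \<subseteq> V"
  shows "near (Suc k) y = (\<Union>z\<in>near k y. insert z (nbrs z))"
proof -
  have "near (Suc k) y = {x. \<exists>z\<in>near k y. (x, z) \<in> edges\<^sup>=}"
    unfolding near_def relpow.simps(2) relpow_commute[symmetric] by (auto simp: relcomp_unfold)
  also have "\<dots> = (\<Union>z\<in>near k y. insert z (nbrs z))"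
    using assms adj_sym by (auto simp: edges_def nbrs_def)
  finally show ?thesis .
qed

text \<open>Each further step multiplies the size of the ball by at most
  \<open>Suc \<Delta>\<close>.\<close>

lemma near_bound:
  assumes \<Delta>: "\<And>v. v \<in> V \<Longrightarrow> card (nbrs v) \<le> \<Delta>" and y: "y \<in> V"
  shows "near k y \<subseteq> V \<and> finite (near k y) \<and> card (near k y) \<le> Suc \<Delta> ^ k"
proof (induction k)
  case 0
  then show ?case using y by (auto simp: near_def)
next
  case (Suc k)
  have *: "near (Suc k) y = (\<Union>z\<in>near k y. insert z (nbrs z))" using near_Suc[OF y] Suc by blast
  have "card (near (Suc k) y) \<le> (\<Sum>z\<in>near k y. card (insert z (nbrs z)))"
    unfolding * using Suc by (intro card_UN_le) auto
  also have "\<dots> \<le> (\<Sum>z\<in>near k y. Suc \<Delta>)"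
    using Suc \<Delta> by (intro sum_mono) (force simp: card_insert_if finite_nbrs' le_SucI)
  also have "\<dots> = Suc \<Delta> * card (near k y)" by simp
  also have "\<dots> \<le> Suc \<Delta> * Suc \<Delta> ^ k" using Suc by (intro mult_le_mono2) blast
  also have "\<dots> = Suc \<Delta> ^ Suc k" by simp
  finally show ?case using Suc finite_nbrs' nbrs_subset unfolding * by fastforce
qed

lemma links_mono: "C \<subseteq> D \<Longrightarrow> (links C)\<^sup>* \<subseteq> (links D)\<^sup>*"
  by (intro rtrancl_mono) (auto simp: links_def)

lemma links_sym: "(x, y) \<in> (links C)\<^sup>* \<Longrightarrow> (y, x) \<in> (links C)\<^sup>*"
  by (rule symD[OF sym_rtrancl]) (auto simp: links_def sym_def adj_sym)

lemma linked_Un: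
  assumes "linked C" "linked D" "z \<in> C" "z \<in> D"
  shows "linked (C \<union> D)"
proof -
  have *: "(x, z) \<in> (links (C \<union> D))\<^sup>*" if "x \<in> C \<union> D" for x
    using that assms links_mono[of C "C \<union> D"] links_mono[of D "C \<union> D"] unfolding linked_def by blast
  show ?thesis unfolding linked_def
    using * links_sym rtrancl_trans by metis
qed

lemma linked_insert:
  assumes "linked C" "x \<in> C" "x = z \<or> adj x z"
  shows "linked (insert z C)"
proof -
  have "linked {x, z}" using assms adj_sym by (auto simp: linked_def links_def intro!: r_into_rtrancl)
  then have "linked (C \<union> {x, z})" using assms by (intro linked_Un[of _ _ x]) auto
  moreover have "C \<union> {x, z} = insert z C" using assms by blast
  ultimately show ?thesis by simp
qed

lemma linked_image:
  assumes f: "f \<in> \<Gamma>" and "linked C" "C \<subseteq> V"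
  shows "linked (f ` C)"
proof -
  have "(f x, f y) \<in> (links (f ` C))\<^sup>*" if "(x, y) \<in> (links C)\<^sup>*" for x y
    using that
  proof (induction rule: rtrancl_induct)
    case (step u v)
    then have "(f u, f v) \<in> links (f ` C)" using adj_iff[OF f] assms by (auto simp: links_def)
    with step show ?case by (meson rtrancl.rtrancl_into_rtrancl)
  qed simp
  then show ?thesis using assms by (auto simp: linked_def)
qed

lemma boundary_image:
  assumes f: "f \<in> \<Gamma>" and C: "C \<subseteq> V"
  shows "boundary (f ` C) = f ` boundary C"
proof
  show "boundary (f ` C) \<subseteq> f ` boundary C"
  proof
    fix w assume w: "w \<in> boundary (f ` C)"
    then have "w \<in> f ` V" using surj[OF f] by (auto simp: boundary_def)
    then obtain v where "v \<in> V" "w = f v" by blast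
    moreover obtain u where "u \<in> C" "adj (f u) w" using w by (auto simp: boundary_def)
    ultimately have "v \<in> boundary C" using w adj_iff[OF f, of u v] C by (auto simp: boundary_def)
    with \<open>w = f v\<close> show "w \<in> f ` boundary C" by blast
  qed
  show "f ` boundary C \<subseteq> boundary (f ` C)"
  proof
    fix w assume "w \<in> f ` boundary C"
    then obtain v u where v: "w = f v" "v \<in> V" "v \<notin> C" "u \<in> C" "adj u v" by (auto simp: boundary_def)
    then have "w \<notin> f ` C" using inj_on_image_mem_iff[OF inj[OF f] v(2) C] by simp
    moreover have "adj (f u) w" using v C adj_iff[OF f, of u v] by blast
    ultimately show "w \<in> boundary (f ` C)" using v maps_to[OF f v(2)] by (auto simp: boundary_def)
  qed
qed

lemma finite_boundary: "finite C \<Longrightarrow> C \<subseteq> V \<Longrightarrow> finite (boundary C)"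
  by (rule finite_subset[of _ "\<Union>c\<in>C. nbrs c"]) (auto simp: boundary_def nbrs_def intro: finite_nbrs)

lemma card_boundary_le:
  assumes \<Delta>: "\<And>v. v \<in> V \<Longrightarrow> card (nbrs v) \<le> \<Delta>" and "finite C" "C \<subseteq> V"
  shows "card (boundary C) \<le> card C * \<Delta>"
proof -
  have "card (boundary C) \<le> card (\<Union>c\<in>C. nbrs c)"
    using assms finite_nbrs' by (intro card_mono) (auto simp: boundary_def nbrs_def)
  also have "\<dots> \<le> (\<Sum>c\<in>C. card (nbrs c))" using assms by (intro card_UN_le)
  also have "\<dots> \<le> (\<Sum>c\<in>C. \<Delta>)" using assms by (intro sum_mono) auto
  finally show ?thesis by simp
qed

lemma card_boundary_Un_le:
  assumes \<Delta>: "\<And>v. v \<in> V \<Longrightarrow> card (nbrs v) \<le> \<Delta>"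
    and "finite C" "C \<subseteq> V" "finite D" "D \<subseteq> V"
  shows "card (boundary (C \<union> D)) \<le> card (boundary C) + card (boundary D)"
proof -
  have "card (boundary (C \<union> D)) \<le> card (boundary C \<union> boundary D)"
    using assms finite_boundary by (intro card_mono) (auto simp: boundary_def)
  also have "\<dots> \<le> card (boundary C) + card (boundary D)" by (rule card_Un_le)
  finally show ?thesis .
qed

text \<open>The path is followed from \<open>x\<close>, and each point \<open>z\<close> on it is
  absorbed into \<open>C\<close>, hence the induction for arbitrary \<open>C\<close>. Only points
  outside \<open>C \<union> D\<close> enter \<open>S\<close>. Confining \<open>S\<close> to a ball
  about \<open>y\<close> later bounds the number of possible \<open>S\<close>.\<close>

lemma path_join:
  assumes "(x, y) \<in> (edges\<^sup>=) ^^ k" "x \<in> C" "linked C" "y \<in> D" "linked D" "y \<in> V"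
  shows "\<exists>S. S \<subseteq> near k y \<and> finite S \<and> card S \<le> k \<and> S \<inter> (C \<union> D) = {} \<and> linked (C \<union> S \<union> D)"
  using assms(1-3)
proof (induction k arbitrary: x C)
  case 0
  then have "linked (C \<union> D)" using assms by (intro linked_Un[of _ _ y]) auto
  then show ?case by (intro exI[of _ "{}"]) auto
next
  case (Suc k)
  obtain z where z: "(x, z) \<in> edges\<^sup>=" "(z, y) \<in> (edges\<^sup>=) ^^ k"
    using relpow_Suc_D2[OF Suc.prems(1)] by blast
  have "linked (insert z C)" using z Suc.prems by (intro linked_insert[of _ x]) (auto simp: edges_def)
  from Suc.IH[OF z(2) _ this] obtain S where
    S: "S \<subseteq> near k y" "finite S" "card S \<le> k" "S \<inter> (insert z C \<union> D) = {}" "linked (insert z C \<union> S \<union> D)"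
    by blast
  have near: "near k y \<subseteq> near (Suc k) y" by (auto simp: near_def intro: relpow_reflcl_mono[of k "Suc k"] simp del: relpow.simps)
  show ?case
  proof (cases "z \<in> C \<union> D")
    case True
    then have "insert z C \<union> S \<union> D = C \<union> S \<union> D" by blast
    with S near show ?thesis by (intro exI[of _ S]) auto
  next
    case False
    have "insert z C \<union> S \<union> D = C \<union> insert z S \<union> D" by blast
    moreover have "z \<in> near k y" using z by (simp add: near_def)
    ultimately show ?thesis using S near False
      by (intro exI[of _ "insert z S"]) (auto simp: card_insert_if)
  qed
qed

text \<open>Iterate the ascending map; each application adds the same positive amount to the
  height.\<close>

lemma exists_higher: "v \<in> V \<Longrightarrow> \<exists>f\<in>\<Gamma>. b < h (f v)"
proof -
  assume v: "v \<in> V"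
  obtain f c where f: "f \<in> \<Gamma>" "0 < c" "\<forall>v\<in>V. h (f v) = h v + c" using ascent by blast
  have *: "\<exists>g\<in>\<Gamma>. h (g v) = h v + real (Suc n) * c" for n
  proof (induction n)
    case 0
    then show ?case using f v by auto
  next
    case (Suc n)
    then obtain g where g: "g \<in> \<Gamma>" "h (g v) = h v + real (Suc n) * c" by blast
    obtain k where "k \<in> \<Gamma>" "\<forall>v\<in>V. k v = f (g v)" using comp[OF f(1) g(1)] by blast
    then show ?case using f(3) g v maps_to[OF g(1) v] by (intro bexI[of _ k]) (auto simp: algebra_simps)
  qed
  obtain n where "b - h v < real n * c" using f ex_less_of_nat_mult by blast
  also have "\<dots> \<le> real (Suc n) * c" using f by simp
  finally have "b < h v + real (Suc n) * c" by simp
  then show ?thesis using *[of n] by metis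
qed

lemma relpow_image:
  assumes f: "f \<in> \<Gamma>"
  shows "(x, y) \<in> (edges\<^sup>=) ^^ k \<Longrightarrow> (f x, f y) \<in> (edges\<^sup>=) ^^ k"
proof (induction k arbitrary: y)
  case (Suc k)
  then obtain z where "(x, z) \<in> (edges\<^sup>=) ^^ k" "(z, y) \<in> edges\<^sup>=" by auto
  moreover from this(2) have "(f z, f y) \<in> edges\<^sup>="
    using maps_to[OF f] adj_iff[OF f] by (auto simp: edges_def)
  ultimately show ?case using Suc.IH relpow_Suc_I by metis
qed simp

text \<open>For each of the finitely many pairs of orbit representatives there is such a path, by
  connectedness. The maximal length serves for all pairs, since powers of a reflexive relation
  increase, and the group carries the paths to arbitrary \<open>x\<close> and
  \<open>y\<close>.\<close>

lemma uniform_path: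
  "\<exists>K. \<forall>x\<in>V. \<forall>y\<in>V. \<exists>f\<in>\<Gamma>. h x < h (f y) \<and> (x, f y) \<in> (edges\<^sup>=) ^^ K"
proof -
  obtain F where F: "finite F" "F \<subseteq> V" "\<forall>v\<in>V. \<exists>f\<in>\<Gamma>. \<exists>r\<in>F. v = f r"
    using finite_orbits by blast
  have "\<exists>k. \<exists>f\<in>\<Gamma>. h r < h (f s) \<and> (r, f s) \<in> (edges\<^sup>=) ^^ k" if "r \<in> F" "s \<in> F" for r s
  proof -
    have V: "r \<in> V" "s \<in> V" using that F(2) by blast+
    obtain f where f: "f \<in> \<Gamma>" "h r < h (f s)" using exists_higher[OF V(2)] by blast
    have "(r, f s) \<in> edges\<^sup>*" unfolding edges_def using connected[OF V(1) maps_to[OF f(1) V(2)]] .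
    then have "(r, f s) \<in> (edges\<^sup>=)\<^sup>*" by simp
    then show ?thesis using f rtrancl_imp_relpow by blast
  qed
  then obtain k where k: "\<And>r s. r \<in> F \<Longrightarrow> s \<in> F \<Longrightarrow>
      \<exists>f\<in>\<Gamma>. h r < h (f s) \<and> (r, f s) \<in> (edges\<^sup>=) ^^ k r s" by metis
  define K where "K = Max ((\<lambda>(r, s). k r s) ` (F \<times> F))"
  have K: "k r s \<le> K" if "r \<in> F" "s \<in> F" for r s
    unfolding K_def using F that by (intro Max_ge) (auto intro: image_eqI[of _ _ "(r, s)"])
  show ?thesis
  proof (intro exI[of _ K] ballI)
    fix x y assume xy: "x \<in> V" "y \<in> V"
    obtain a r where a: "a \<in> \<Gamma>" "r \<in> F" "x = a r" using bspec[OF F(3) xy(1)] by blast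
    obtain b s where b: "b \<in> \<Gamma>" "s \<in> F" "y = b s" using bspec[OF F(3) xy(2)] by blast
    have V: "r \<in> V" "s \<in> V" using a b F(2) by blast+
    obtain f where f: "f \<in> \<Gamma>" "h r < h (f s)" "(r, f s) \<in> (edges\<^sup>=) ^^ k r s"
      using k[OF a(2) b(2)] by blast
    obtain b' where b': "b' \<in> \<Gamma>" "b' (b s) = s" using left_inverse[OF b(1)] V by blast
    have "(r, f s) \<in> (edges\<^sup>=) ^^ K" using K[OF a(2) b(2)] f(3) by (rule relpow_reflcl_mono)
    then have "(x, a (f s)) \<in> (edges\<^sup>=) ^^ K" unfolding a(3) by (rule relpow_image[OF a(1)])
    moreover obtain c where "\<forall>v\<in>V. h (a v) = h v + c" using height[OF a(1)] by blast
    then have "h x < h (a (f s))" using V f maps_to[OF f(1) V(2)] a(3) by simp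
    \<comment> \<open>The map sought is the composite of \<open>b'\<close>, \<open>f\<close> and
      \<open>a\<close>, which sends \<open>y = b s\<close> to \<open>a (f s)\<close>.\<close>
    moreover obtain k where k: "k \<in> \<Gamma>" "\<forall>v\<in>V. k v = f (b' v)" using comp[OF f(1) b'(1)] by blast
    obtain l where "l \<in> \<Gamma>" "\<forall>v\<in>V. l v = a (k v)" using comp[OF a(1) k(1)] by blast
    ultimately show "\<exists>g\<in>\<Gamma>. h x < h (g y) \<and> (x, g y) \<in> (edges\<^sup>=) ^^ K"
      using k(2) b'(2) b(3) xy(2) by (intro bexI[of _ l]) auto
  qed
qed

text \<open>A set with empty boundary is closed under adjacency, so by connectedness it contains
  points above any given height, which a finite set cannot.\<close>

lemma boundary_nonempty:
  assumes "finite C" "C \<subseteq> V" "C \<noteq> {}"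
  shows "boundary C \<noteq> {}"
proof
  assume e: "boundary C = {}"
  obtain x where x: "x \<in> C" using assms by blast
  obtain f where f: "f \<in> \<Gamma>" "Max (h ` C) < h (f x)" using exists_higher x assms by blast
  have "(x, f x) \<in> edges\<^sup>*" unfolding edges_def using connected maps_to f x assms by blast
  then have "f x \<in> C"
    by (induction rule: rtrancl_induct) (use x e in \<open>auto simp: edges_def boundary_def\<close>)
  then have "h (f x) \<le> Max (h ` C)" using assms by (intro Max_ge) auto
  with f show False by simp
qed

end

section \<open>Gluing animals\<close>

text \<open>Site percolation takes a single root vertex; bond percolation takes the star of the
  vertex as root set in the line graph. Adjacency of distinct roots merges the clusters of all open
  roots into one connected set.\<close>

locale rooted_periodic_graph = periodic_graph +
  fixes A :: "'a set"
  assumes root_subset: "A \<subseteq> V" and root_finite: "finite A" and root_nonempty: "A \<noteq> {}"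
    and root_clique: "a \<in> A \<Longrightarrow> b \<in> A \<Longrightarrow> a \<noteq> b \<Longrightarrow> adj a b"
begin

definition animals :: "nat \<Rightarrow> 'a set set" where
  "animals n = {C. C \<subseteq> V \<and> finite C \<and> card C = n \<and> linked C \<and> C \<inter> A \<noteq> {}}"

definition Q :: "real \<Rightarrow> nat \<Rightarrow> real" where
  "Q p n = (\<Sum>C\<in>animals n. weight p C)"

lemma animalsD:
  assumes "C \<in> animals n"
  shows "C \<subseteq> V" "finite C" "card C = n" "linked C" "C \<inter> A \<noteq> {}" "C \<noteq> {}"
  using assms by (auto simp: animals_def)

text \<open>All animals of size \<open>n\<close> lie in the balls of radius \<open>n * n\<close>
  about the roots. This crude radius bounds the number of ordered pairs of points of
  \<open>C\<close>, and hence the length of a shortest path inside \<open>C\<close>.\<close>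

lemma finite_animals: "finite (animals n)"
proof -
  obtain \<Delta> where \<Delta>: "\<And>v. v \<in> V \<Longrightarrow> card (nbrs v) \<le> \<Delta>" using degree_bound by blast
  have "c \<in> (\<Union>a\<in>A. near (n * n) a)" if C: "C \<in> animals n" and c: "c \<in> C" for C c
  proof -
    obtain a where a: "a \<in> A" "a \<in> C" using animalsD[OF C] by blast
    have sub: "links C \<subseteq> C \<times> C" by (auto simp: links_def)
    have fin: "finite (links C)" using animalsD[OF C] finite_subset[OF sub] by simp
    have card: "card (links C) \<le> n * n"
      using card_mono[OF _ sub] animalsD[OF C] by (simp add: card_cartesian_product)
    have "(c, a) \<in> (links C)\<^sup>*" using animalsD[OF C] a c by (auto simp: linked_def)
    then obtain k where "k \<le> card (links C)" "(c, a) \<in> links C ^^ k"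
      by (auto simp: rtrancl_finite_eq_relpow[OF fin])
    with card have k: "k \<le> n * n" "(c, a) \<in> links C ^^ k" by auto
    have "links C \<subseteq> edges\<^sup>=" using animalsD[OF C] by (auto simp: links_def edges_def)
    then have "(c, a) \<in> (edges\<^sup>=) ^^ k" using k(2) relpow_subset by blast
    then have "(c, a) \<in> (edges\<^sup>=) ^^ (n * n)" by (rule relpow_reflcl_mono[OF k(1)])
    then show ?thesis using a(1) by (auto simp: near_def)
  qed
  then have "animals n \<subseteq> Pow (\<Union>a\<in>A. near (n * n) a)" by blast
  moreover have "finite (\<Union>a\<in>A. near (n * n) a)"
    using near_bound[OF \<Delta>] root_finite root_subset by blast
  ultimately show ?thesis by (meson finite_Pow_iff finite_subset)
qed

lemma weight_nonneg: "0 \<le> p \<Longrightarrow> p \<le> 1 \<Longrightarrow> 0 \<le> weight p C"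
  by (simp add: weight_def)

lemma weight_pos: "0 < p \<Longrightarrow> p < 1 \<Longrightarrow> 0 < weight p C"
  by (simp add: weight_def)

lemma Q_nonneg: "0 \<le> p \<Longrightarrow> p \<le> 1 \<Longrightarrow> 0 \<le> Q p n"
  by (simp add: Q_def sum_nonneg weight_nonneg)

lemma card_subset_Un:
  assumes "finite Y" "Y \<subseteq> U \<union> S" "U \<subseteq> Y" "finite S" "finite U"
  shows "card Y \<le> card U + card S" "card U \<le> card Y"
proof -
  have "card Y \<le> card (U \<union> S)" using assms by (intro card_mono) auto
  also have "\<dots> \<le> card U + card S" by (rule card_Un_le)
  finally show "card Y \<le> card U + card S" .
  show "card U \<le> card Y" using assms by (intro card_mono)
qed

text \<open>A gluing: \<open>f\<close> moves \<open>D\<close> strictly above \<open>C\<close>, with \<open>f y\<close> the lowest point of the image, and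
  \<open>S\<close> is the part outside both animals of a path ending at \<open>f y\<close>.\<close>

definition glues :: "nat \<Rightarrow> 'a set \<Rightarrow> 'a set \<Rightarrow> 'a set \<times> ('a \<Rightarrow> 'a) \<times> 'a \<Rightarrow> bool" where
  "glues K C D = (\<lambda>(S, f, y). f \<in> \<Gamma> \<and> y \<in> D \<and> S \<subseteq> near K (f y) \<and> finite S \<and> card S \<le> K \<and>
     S \<inter> (C \<union> f ` D) = {} \<and> linked (C \<union> S \<union> f ` D) \<and>
     (\<forall>c\<in>C. h c < h (f y)) \<and> (\<forall>d\<in>D. h (f y) \<le> h (f d)))"

definition glued :: "'a set \<Rightarrow> 'a set \<Rightarrow> 'a set \<times> ('a \<Rightarrow> 'a) \<times> 'a \<Rightarrow> 'a set" where
  "glued C D = (\<lambda>(S, f, y). C \<union> S \<union> f ` D)"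

text \<open>Take \<open>x\<close> highest in \<open>C\<close> and \<open>y\<close> lowest in
  \<open>D\<close>, and join \<open>x\<close> to a translate of \<open>y\<close> that lies above
  it.\<close>

lemma glues_exists:
  assumes K: "\<And>x y. x \<in> V \<Longrightarrow> y \<in> V \<Longrightarrow> \<exists>f\<in>\<Gamma>. h x < h (f y) \<and> (x, f y) \<in> (edges\<^sup>=) ^^ K"
    and C: "C \<in> animals n" and D: "D \<in> animals m"
  shows "\<exists>t. glues K C D t"
proof -
  have "Max (h ` C) \<in> h ` C" using animalsD[OF C] by (intro Max_in) auto
  then obtain x where x: "x \<in> C" "h x = Max (h ` C)" by auto
  have "Min (h ` D) \<in> h ` D" using animalsD[OF D] by (intro Min_in) auto
  then obtain y where y: "y \<in> D" "h y = Min (h ` D)" by auto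
  have xC: "h c \<le> h x" if "c \<in> C" for c using x that animalsD[OF C] by simp
  have yD: "h y \<le> h d" if "d \<in> D" for d using y that animalsD[OF D] by simp
  have V: "x \<in> V" "y \<in> V" using x y animalsD(1)[OF C] animalsD(1)[OF D] by auto
  obtain f where f: "f \<in> \<Gamma>" "h x < h (f y)" "(x, f y) \<in> (edges\<^sup>=) ^^ K" using K[OF V] by blast
  \<comment> \<open>Since \<open>f\<close> changes all heights by the same \<open>c\<close>, the
    point \<open>f y\<close> is lowest in the image of \<open>D\<close>.\<close>
  obtain c where c: "\<forall>v\<in>V. h (f v) = h v + c" using height f by blast
  obtain S where S: "S \<subseteq> near K (f y)" "finite S" "card S \<le> K" "S \<inter> (C \<union> f ` D) = {}" "linked (C \<union> S \<union> f ` D)"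
    using path_join[OF f(3) x(1), of "f ` D"] animalsD[OF C] animalsD[OF D] linked_image[OF f(1)] y
      maps_to[OF f(1) V(2)] by blast
  have "\<forall>c\<in>C. h c < h (f y)" using xC f by force
  moreover have "\<forall>d\<in>D. h (f y) \<le> h (f d)" using yD c V animalsD(1)[OF D] by (simp add: subset_iff)
  ultimately have "glues K C D (S, f, y)" using S f y by (simp add: glues_def)
  then show ?thesis by blast
qed

text \<open>The strict separation in height makes \<open>C\<close> and the image of \<open>D\<close>
  disjoint, so the sizes add up, with \<open>card S\<close> as the excess. The result meets the root
  set because \<open>C\<close> does.\<close>

lemma glued_animal:
  assumes g: "glues K C D t" and C: "C \<in> animals n" and D: "D \<in> animals m"
  shows "\<exists>k\<le>K. glued C D t \<in> animals (n + m + k)"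
proof -
  obtain S f y where t: "t = (S, f, y)" by (cases t)
  have g: "f \<in> \<Gamma>" "y \<in> D" "S \<subseteq> near K (f y)" "finite S" "card S \<le> K" "S \<inter> (C \<union> f ` D) = {}"
    "linked (C \<union> S \<union> f ` D)" "\<forall>c\<in>C. h c < h (f y)" "\<forall>d\<in>D. h (f y) \<le> h (f d)"
    using g unfolding t glues_def by auto
  obtain \<Delta> where \<Delta>: "\<And>v. v \<in> V \<Longrightarrow> card (nbrs v) \<le> \<Delta>" using degree_bound by blast
  note CD = animalsD[OF C] animalsD[OF D]
  have "f y \<in> V" using g CD maps_to by blast
  then have "S \<subseteq> V" using near_bound[OF \<Delta>] g(3) by blast
  moreover have "f ` D \<subseteq> V" using CD(7) surj[OF g(1)] by blast
  moreover have cD: "card (f ` D) = m"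
    using CD(9) card_image[OF inj_on_subset[OF inj[OF g(1)] CD(7)]] by simp
  moreover have "C \<inter> f ` D = {}" using g(8,9) by fastforce
  then have "card (C \<union> S \<union> f ` D) = n + card S + m"
    using g(4,6) CD(2,3,8) cD by (subst card_Un_disjoint; (subst card_Un_disjoint)?) auto
  ultimately have "C \<union> S \<union> f ` D \<in> animals (n + m + card S)"
    using CD(1,2,5,8) g(4,7) by (auto simp: animals_def)
  then show ?thesis using g(5) by (auto simp: t glued_def)
qed

text \<open>Boundary sizes are subadditive, and the at most \<open>K\<close> points of
  \<open>S\<close> contribute at most \<open>K * \<Delta>\<close>. Larger exponents only decrease
  the powers of \<open>p\<close> and \<open>1 - p\<close>.\<close>

lemma weight_glued:
  assumes \<Delta>: "\<And>v. v \<in> V \<Longrightarrow> card (nbrs v) \<le> \<Delta>"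
    and g: "glues K C D t" and C: "C \<in> animals n" and D: "D \<in> animals m" and p: "0 < p" "p < 1"
  shows "p ^ K * (1 - p) ^ (K * \<Delta>) * (weight p C * weight p D) \<le> weight p (glued C D t)"
proof -
  obtain S f y where t: "t = (S, f, y)" by (cases t)
  obtain k where k: "k \<le> K" "glued C D t \<in> animals (n + m + k)" using glued_animal[OF g C D] by blast
  have g: "f \<in> \<Gamma>" "y \<in> D" "S \<subseteq> near K (f y)" "finite S" "card S \<le> K"
    using g unfolding t glues_def by auto
  note CD = animalsD[OF C] animalsD[OF D]
  have fD: "f ` D \<subseteq> V" using CD maps_to g by blast
  have "f y \<in> V" using g CD maps_to by blast
  then have S: "S \<subseteq> V" using near_bound[OF \<Delta>] g by blast
  have "card (boundary (f ` D)) \<le> card (boundary D)"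
    using boundary_image[OF g(1)] CD finite_boundary by (simp add: card_image_le)
  moreover have "card (boundary S) \<le> K * \<Delta>"
    using card_boundary_le[OF \<Delta> g(4) S] mult_le_mono1[OF g(5), of \<Delta>] by linarith
  moreover have "card (boundary (C \<union> S \<union> f ` D)) \<le> card (boundary C) + card (boundary S) + card (boundary (f ` D))"
    using card_boundary_Un_le[OF \<Delta>, of "C \<union> S" "f ` D"] card_boundary_Un_le[OF \<Delta>, of C S] CD g fD S by simp
  ultimately have b: "card (boundary (glued C D t)) \<le> card (boundary C) + card (boundary D) + K * \<Delta>"
    by (simp add: t glued_def)
  have "p ^ K * (1 - p) ^ (K * \<Delta>) * (weight p C * weight p D) =
      p ^ (n + m + K) * (1 - p) ^ (card (boundary C) + card (boundary D) + K * \<Delta>)"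
    using CD by (simp add: weight_def power_add mult_ac)
  also have "\<dots> \<le> weight p (glued C D t)"
    unfolding weight_def using animalsD(3)[OF k(2)] k(1) b p
    by (intro mult_mono power_decreasing) auto
  finally show ?thesis .
qed

text \<open>The pair is encoded by the part \<open>L\<close> of \<open>X\<close> at or above the
  height of \<open>f y\<close>, the point \<open>f y\<close>, the path part \<open>S\<close>, a root
  in \<open>D\<close> and the image of this root. The image determines \<open>f\<close> by freeness,
  then \<open>L - S\<close> is the image of \<open>D\<close>, and \<open>X - L - S\<close> is
  \<open>C\<close>. Everything except \<open>L\<close> lives in sets whose size does not depend on
  \<open>n\<close>, and there are few candidates for \<open>L\<close>.\<close>

lemma card_fibre_le:
  assumes b: "\<And>y. y \<in> V \<Longrightarrow> near K y \<subseteq> V \<and> finite (near K y) \<and> card (near K y) \<le> b"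
    and T: "\<And>P. P \<in> animals n \<times> animals m \<Longrightarrow> glues K (fst P) (snd P) (T P)"
    and X: "X \<subseteq> V" "finite X"
  shows "card {P \<in> animals n \<times> animals m. glued (fst P) (snd P) (T P) = X}
    \<le> Suc K * ((m + K) * 2 ^ b * (card A * (m + K)))" (is "card ?F \<le> _")
proof -
  \<comment> \<open>Upper level sets of \<open>X\<close> of admissible size: \<open>L\<close>
    contains the image of \<open>D\<close> and otherwise only points of \<open>S\<close>.\<close>
  define Lev where "Lev = {L. (\<exists>s. L = {v\<in>X. s \<le> h v}) \<and> m \<le> card L \<and> card L \<le> m + K}"
  define Cod where "Cod L = {L} \<times> (Sigma L (\<lambda>y. Pow (near K y)) \<times> (A \<times> L))" for L
  \<comment> \<open>An animal meets \<open>A\<close>, so \<open>D\<close> supplies a point with only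
    \<open>card A\<close> possible values. Recording its image costs at most \<open>m + K\<close>
    choices, as the image lies in \<open>L\<close>.\<close>
  define root where "root P = (SOME a. a \<in> A \<inter> snd P)" for P :: "'a set \<times> 'a set"
  define code where "code P = (case T P of (S, f, y) \<Rightarrow>
    ({v\<in>X. h (f y) \<le> h v}, (f y, S), (root P, f (root P))))" for P
  have *: "f \<in> \<Gamma> \<and> f y \<in> L \<and> S \<subseteq> near K (f y) \<and> L \<in> Lev \<and> f ` snd P = L - S \<and> fst P = X - L - S \<and>
      root P \<in> A \<and> root P \<in> V \<and> f (root P) \<in> L \<and> snd P = {v\<in>V. f v \<in> L - S}"
    if P: "P \<in> ?F" and t: "T P = (S, f, y)" and L: "L = {v\<in>X. h (f y) \<le> h v}" for P S f y L
  proof -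
    obtain C D where CD: "P = (C, D)" by (cases P)
    have an: "C \<in> animals n" "D \<in> animals m" using P CD by auto
    note CDD = animalsD[OF an(1)] animalsD[OF an(2)]
    have X_eq: "X = C \<union> S \<union> f ` D" using P t CD by (simp add: glued_def)
    have g: "f \<in> \<Gamma>" "y \<in> D" "S \<subseteq> near K (f y)" "finite S" "card S \<le> K" "S \<inter> (C \<union> f ` D) = {}"
      "\<forall>c\<in>C. h c < h (f y)" "\<forall>d\<in>D. h (f y) \<le> h (f d)"
      using T[of P] P t CD unfolding glues_def by auto
    have cD: "card (f ` D) = m" using CDD card_image inj_on_subset[OF inj[OF g(1)]] by metis
    have "c \<notin> L" if "c \<in> C" for c using g(7) that by (auto simp: L not_le)
    moreover have "L \<subseteq> C \<union> S \<union> f ` D" unfolding L X_eq[symmetric] by blast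
    ultimately have LD: "f ` D \<subseteq> L" "L \<subseteq> f ` D \<union> S" "C \<inter> L = {}"
      using g(8) unfolding L X_eq by auto
    have "finite L" using L X by simp
    from card_subset_Un[OF this LD(2,1) g(4)] have "m \<le> card L" "card L \<le> m + K"
      using cD g(5) CDD by auto
    then have "L \<in> Lev" using L unfolding Lev_def by blast
    moreover have fD: "f ` D = L - S" "C = X - L - S" using LD g(6) X_eq by auto
    moreover have r: "root P \<in> A \<inter> D" unfolding root_def CD snd_conv
      using CDD by (intro someI_ex[of "\<lambda>a. a \<in> A \<inter> D"]) auto
    \<comment> \<open>Injectivity of \<open>f\<close> on \<open>V\<close> recovers \<open>D\<close>
      as the preimage of \<open>L - S\<close>.\<close>
    moreover have "D = {v\<in>V. f v \<in> f ` D}" using CDD inj[OF g(1)] by (auto simp: inj_on_def subset_iff)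
    ultimately show ?thesis using g CD LD root_subset by auto
  qed
  have "inj_on code ?F"
  proof (rule inj_onI)
    fix P P' assume P: "P \<in> ?F" "P' \<in> ?F" and eq: "code P = code P'"
    obtain S f y where t: "T P = (S, f, y)" by (cases "T P")
    obtain S' f' y' where t': "T P' = (S', f', y')" by (cases "T P'")
    let ?L = "{v\<in>X. h (f y) \<le> h v}"
    from eq have e: "?L = {v\<in>X. h (f' y') \<le> h v}" "S = S'" "root P = root P'" "f (root P) = f' (root P)"
      by (auto simp: code_def t t')
    note 1 = *[OF P(1) t refl] and 2 = *[OF P(2) t' e(1)]
    have "f v = f' v" if "v \<in> V" for v
      using free[of f f' "root P" v] 1 2 e(4) that by blast
    then have "snd P = snd P'" using 1 2 e by auto
    moreover have "fst P = fst P'" using 1 2 e by metis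
    ultimately show "P = P'" by (simp add: prod_eq_iff)
  qed
  then have "card ?F = card (code ` ?F)" by (simp add: card_image)
  have fLev: "finite Lev" by (rule finite_subset[of _ "Pow X"]) (use X in \<open>auto simp: Lev_def\<close>)
  have Lsub: "L \<subseteq> V" "finite L" "card L \<le> m + K" if "L \<in> Lev" for L
    using that X by (auto simp: Lev_def)
  have fCod: "finite (Cod L)" if "L \<in> Lev" for L
    unfolding Cod_def using Lsub[OF that] b root_finite
    by (intro finite_cartesian_product finite_SigmaI) auto
  have "code ` ?F \<subseteq> (\<Union>L\<in>Lev. Cod L)"
  proof
    fix z assume "z \<in> code ` ?F"
    then obtain P where P: "P \<in> ?F" "z = code P" by blast
    obtain S f y where t: "T P = (S, f, y)" by (cases "T P")
    show "z \<in> (\<Union>L\<in>Lev. Cod L)" using *[OF P(1) t refl] P(2) by (auto simp: code_def t Cod_def)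
  qed
  then have "card (code ` ?F) \<le> card (\<Union>L\<in>Lev. Cod L)" using fLev fCod by (intro card_mono) auto
  also have "\<dots> \<le> (\<Sum>L\<in>Lev. card (Cod L))" using fLev by (rule card_UN_le)
  also have "\<dots> \<le> (\<Sum>L\<in>Lev. (m + K) * 2 ^ b * (card A * (m + K)))"
  proof (rule sum_mono)
    fix L assume L: "L \<in> Lev"
    have "card (Sigma L (\<lambda>y. Pow (near K y))) = (\<Sum>y\<in>L. 2 ^ card (near K y))"
      using Lsub[OF L] b by (subst card_SigmaI) (auto simp: card_Pow subset_iff)
    also have "\<dots> \<le> (\<Sum>y\<in>L. 2 ^ b)" using Lsub[OF L] b by (intro sum_mono power_increasing) auto
    also have "\<dots> = card L * 2 ^ b" by simp
    also have "\<dots> \<le> (m + K) * 2 ^ b" using Lsub[OF L] by (intro mult_le_mono1)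
    finally have "card (Sigma L (\<lambda>y. Pow (near K y))) \<le> (m + K) * 2 ^ b" .
    then show "card (Cod L) \<le> (m + K) * 2 ^ b * (card A * (m + K))"
      unfolding Cod_def using Lsub[OF L] by (simp add: card_cartesian_product mult_le_mono)
  qed
  also have "\<dots> = card Lev * ((m + K) * 2 ^ b * (card A * (m + K)))" by simp
  \<comment> \<open>Upper level sets are nested, so each is determined by its size, for which there
    are only \<open>K + 1\<close> values.\<close>
  also have "card Lev \<le> card {m..m + K}"
  proof (rule card_inj_on_le[of card])
    show "inj_on card Lev"
    proof (rule inj_onI)
      fix L L' assume L: "L \<in> Lev" "L' \<in> Lev" "card L = card L'"
      then obtain s s' where s: "L = {v\<in>X. s \<le> h v}" "L' = {v\<in>X. s' \<le> h v}" by (auto simp: Lev_def)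
      have "L \<subseteq> L' \<or> L' \<subseteq> L" unfolding s by (cases "s \<le> s'") auto
      then show "L = L'" using L Lsub card_subset_eq by metis
    qed
  qed (auto simp: Lev_def)
  finally show ?thesis using \<open>card ?F = card (code ` ?F)\<close> by (simp add: mult_le_mono1)
qed

end

section \<open>The growth rate of cluster sizes\<close>

context rooted_periodic_graph
begin

text \<open>Sum \<open>weight_glued\<close> over all pairs and group the pairs by their glued
  animal. The fibres are bounded by \<open>card_fibre_le\<close>, with
  \<open>Suc \<Delta> ^ K\<close> bounding the balls; the glued animals are distributed over the
  sizes \<open>n + m + k\<close>.\<close>

lemma Q_glue:
  assumes \<Delta>: "\<And>v. v \<in> V \<Longrightarrow> card (nbrs v) \<le> \<Delta>"
    and K: "\<And>x y. x \<in> V \<Longrightarrow> y \<in> V \<Longrightarrow> \<exists>f\<in>\<Gamma>. h x < h (f y) \<and> (x, f y) \<in> (edges\<^sup>=) ^^ K"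
    and p: "0 < p" "p < 1"
  shows "p ^ K * (1 - p) ^ (K * \<Delta>) * (Q p n * Q p m)
    \<le> real (Suc K * ((m + K) * 2 ^ (Suc \<Delta> ^ K) * (card A * (m + K)))) * (\<Sum>k\<le>K. Q p (n + m + k))"
proof -
  define B where "B = Suc K * ((m + K) * 2 ^ (Suc \<Delta> ^ K) * (card A * (m + K)))"
  define P where "P = animals n \<times> animals m"
  have "\<exists>t. glues K (fst x) (snd x) t" if "x \<in> P" for x
    using glues_exists[OF K, of "fst x" n "snd x" m] that by (auto simp: P_def)
  then obtain T where T: "\<And>x. x \<in> P \<Longrightarrow> glues K (fst x) (snd x) (T x)" by metis
  define gl where "gl x = glued (fst x) (snd x) (T x)" for x
  have disj: "animals i \<inter> animals j = {}" if "i \<noteq> j" for i j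
    using that by (auto simp: animals_def)
  have finP: "finite P" by (simp add: P_def finite_animals)
  have gl: "\<exists>k\<le>K. gl x \<in> animals (n + m + k)" if "x \<in> P" for x
    using glued_animal[OF T[OF that]] that by (auto simp: gl_def P_def)
  have "p ^ K * (1 - p) ^ (K * \<Delta>) * (Q p n * Q p m) =
      (\<Sum>x\<in>P. p ^ K * (1 - p) ^ (K * \<Delta>) * (weight p (fst x) * weight p (snd x)))"
    unfolding Q_def sum_product P_def by (simp add: sum.cartesian_product sum_distrib_left case_prod_beta)
  also have "\<dots> \<le> (\<Sum>x\<in>P. weight p (gl x))"
    unfolding gl_def using weight_glued[OF \<Delta> T _ _ p] by (intro sum_mono) (auto simp: P_def)
  also have "\<dots> = (\<Sum>X\<in>gl ` P. \<Sum>x\<in>{x\<in>P. gl x = X}. weight p (gl x))"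
    by (rule sum.image_gen[OF finP])
  also have "\<dots> = (\<Sum>X\<in>gl ` P. real (card {x\<in>P. gl x = X}) * weight p X)"
    by (intro sum.cong) auto
  also have "\<dots> \<le> (\<Sum>X\<in>gl ` P. real B * weight p X)"
  proof (intro sum_mono mult_right_mono)
    fix X assume "X \<in> gl ` P"
    then obtain k where "X \<in> animals (n + m + k)" using gl by blast
    then have X: "X \<subseteq> V" "finite X" using animalsD by blast+
    have "card {x\<in>P. gl x = X} \<le> B"
      unfolding P_def gl_def B_def
      by (rule card_fibre_le[OF near_bound[OF \<Delta>] _ X]) (auto simp: P_def intro: T)
    then show "real (card {x\<in>P. gl x = X}) \<le> real B" by simp
    show "0 \<le> weight p X" using p by (intro weight_nonneg) auto
  qed
  also have "\<dots> = real B * (\<Sum>X\<in>gl ` P. weight p X)" by (simp add: sum_distrib_left)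
  also have "(\<Sum>X\<in>gl ` P. weight p X) \<le> (\<Sum>X\<in>(\<Union>k\<in>{..K}. animals (n + m + k)). weight p X)"
    using gl p by (intro sum_mono2) (auto simp: finite_animals intro: weight_nonneg)
  also have "\<dots> = (\<Sum>k\<le>K. Q p (n + m + k))"
    unfolding Q_def by (rule sum.UNION_disjoint) (simp_all add: finite_animals disj)
  finally show ?thesis by (simp add: B_def mult_left_mono)
qed

text \<open>Adding a boundary point costs one factor \<open>p\<close> and at most
  \<open>\<Delta>\<close> new boundary points. The enlarged animal arises from at most
  \<open>Suc n\<close> animals, since the original is obtained by deleting one of its
  points.\<close>

lemma Q_pad:
  assumes \<Delta>: "\<And>v. v \<in> V \<Longrightarrow> card (nbrs v) \<le> \<Delta>" and p: "0 < p" "p < 1"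
  shows "p * (1 - p) ^ \<Delta> * Q p n \<le> real (Suc n) * Q p (Suc n)"
proof -
  have "\<exists>v. v \<in> boundary C" if "C \<in> animals n" for C
    using boundary_nonempty animalsD[OF that] by blast
  then obtain v where v: "\<And>C. C \<in> animals n \<Longrightarrow> v C \<in> boundary C" by metis
  define ext where "ext C = insert (v C) C" for C
  have ext: "ext C \<in> animals (Suc n)" if C: "C \<in> animals n" for C
  proof -
    obtain u where "u \<in> C" "adj u (v C)" "v C \<notin> C" "v C \<in> V" using v[OF C] by (auto simp: boundary_def)
    then show ?thesis using animalsD[OF C] linked_insert[of C u "v C"] by (auto simp: ext_def animals_def)
  qed
  have w: "p * (1 - p) ^ \<Delta> * weight p C \<le> weight p (ext C)" if C: "C \<in> animals n" for C
  proof -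
    have vV: "v C \<in> V" using v[OF C] by (auto simp: boundary_def)
    have "card (boundary {v C}) \<le> \<Delta>" using card_boundary_le[OF \<Delta>, of "{v C}"] vV by simp
    then have "card (boundary (ext C)) \<le> card (boundary C) + \<Delta>"
      using card_boundary_Un_le[OF \<Delta>, of "{v C}" C] vV animalsD[OF C] by (simp add: ext_def)
    then have "p ^ Suc n * (1 - p) ^ (card (boundary C) + \<Delta>) \<le> weight p (ext C)"
      unfolding weight_def animalsD(3)[OF ext[OF C]] using p
      by (intro mult_left_mono power_decreasing) auto
    then show ?thesis using animalsD[OF C] by (simp add: weight_def power_add mult_ac)
  qed
  have "p * (1 - p) ^ \<Delta> * Q p n = (\<Sum>C\<in>animals n. p * (1 - p) ^ \<Delta> * weight p C)"
    by (simp add: Q_def sum_distrib_left)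
  also have "\<dots> \<le> (\<Sum>C\<in>animals n. weight p (ext C))" using w by (rule sum_mono)
  also have "\<dots> = (\<Sum>X\<in>ext ` animals n. \<Sum>C\<in>{C\<in>animals n. ext C = X}. weight p (ext C))"
    by (rule sum.image_gen[OF finite_animals])
  also have "\<dots> = (\<Sum>X\<in>ext ` animals n. real (card {C\<in>animals n. ext C = X}) * weight p X)"
    by (intro sum.cong) auto
  also have "\<dots> \<le> (\<Sum>X\<in>ext ` animals n. real (Suc n) * weight p X)"
  proof (intro sum_mono mult_right_mono)
    fix X assume "X \<in> ext ` animals n"
    then have X: "X \<in> animals (Suc n)" using ext by blast
    have "{C\<in>animals n. ext C = X} \<subseteq> (\<lambda>x. X - {x}) ` X"
      using v by (auto simp: ext_def boundary_def)
    then have "card {C\<in>animals n. ext C = X} \<le> card ((\<lambda>x. X - {x}) ` X)"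
      using animalsD(2)[OF X] by (intro card_mono) auto
    also have "\<dots> \<le> Suc n" using card_image_le[OF animalsD(2)[OF X]] animalsD(3)[OF X] by simp
    finally have "card {C\<in>animals n. ext C = X} \<le> Suc n" .
    then show "real (card {C\<in>animals n. ext C = X}) \<le> real (Suc n)" by simp
    show "0 \<le> weight p X" using p by (intro weight_nonneg) auto
  qed
  also have "\<dots> = real (Suc n) * (\<Sum>X\<in>ext ` animals n. weight p X)" by (simp add: sum_distrib_left)
  also have "(\<Sum>X\<in>ext ` animals n. weight p X) \<le> Q p (Suc n)"
    unfolding Q_def using ext p by (intro sum_mono2) (auto simp: finite_animals intro: weight_nonneg)
  finally show ?thesis by (simp add: mult_left_mono)
qed

lemma Q_pos:
  assumes p: "0 < p" "p < 1"
  shows "0 < n \<Longrightarrow> 0 < Q p n"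
proof (induction n rule: nat_induct_non_zero)
  case 1
  obtain a where a: "a \<in> A" using root_nonempty by blast
  have "{a} \<in> animals 1" using a root_subset by (auto simp: animals_def linked_def)
  then show ?case unfolding Q_def using p finite_animals by (intro sum_pos) (auto intro: weight_pos)
next
  case (Suc n)
  obtain \<Delta> where \<Delta>: "\<And>v. v \<in> V \<Longrightarrow> card (nbrs v) \<le> \<Delta>" using degree_bound by blast
  have "0 < p * (1 - p) ^ \<Delta> * Q p n" using p Suc by simp
  also have "\<dots> \<le> real (Suc n) * Q p (Suc n)" by (rule Q_pad[OF \<Delta> p])
  finally show ?case by (simp add: zero_less_mult_iff)
qed

text \<open>For a single animal the weights differ by the factor
  \<open>(q / p) ^ n * ((1 - q) / (1 - p)) ^ b\<close> with boundary size
  \<open>b \<le> \<Delta> * n\<close>. Cutting the second base off at 1 allows \<open>b\<close> to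
  be replaced by its upper bound.\<close>

lemma Q_ratio:
  assumes \<Delta>: "\<And>v. v \<in> V \<Longrightarrow> card (nbrs v) \<le> \<Delta>" and p: "0 < p" "p < 1" and q: "0 < q" "q < 1"
  shows "Q p n * (q / p * min 1 ((1 - q) / (1 - p)) ^ \<Delta>) ^ n \<le> Q q n"
  unfolding Q_def sum_distrib_right
proof (rule sum_mono)
  fix C assume C: "C \<in> animals n"
  let ?b = "card (boundary C)" and ?r = "min 1 ((1 - q) / (1 - p))"
  have r: "0 \<le> ?r" "?r \<le> 1" using p q by auto
  have b: "?b \<le> \<Delta> * n" using card_boundary_le[OF \<Delta> animalsD(2,1)[OF C]] animalsD(3)[OF C] by (simp add: mult.commute)
  have "(?r ^ \<Delta>) ^ n \<le> ?r ^ ?b" unfolding power_mult[symmetric] using r b by (rule power_decreasing[rotated])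
  also have "\<dots> \<le> ((1 - q) / (1 - p)) ^ ?b" using r by (intro power_mono) auto
  finally have "weight p C * ((q / p) ^ n * (?r ^ \<Delta>) ^ n) \<le> weight p C * ((q / p) ^ n * ((1 - q) / (1 - p)) ^ ?b)"
    using p q by (intro mult_left_mono weight_nonneg) auto
  also have "\<dots> = weight q C" using p animalsD[OF C] by (simp add: weight_def power_divide)
  finally show "weight p C * (q / p * ?r ^ \<Delta>) ^ n \<le> weight q C" by (simp only: power_mult_distrib)
qed

lemma root_Q_convergent:
  assumes p: "0 < p" "p < 1" and le1: "\<And>n. 0 < n \<Longrightarrow> Q p n \<le> 1"
  shows "convergent (\<lambda>n. root n (Q p n))"
proof -
  obtain \<Delta> where \<Delta>: "\<And>v. v \<in> V \<Longrightarrow> card (nbrs v) \<le> \<Delta>" using degree_bound by blast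
  obtain K where K: "\<And>x y. x \<in> V \<Longrightarrow> y \<in> V \<Longrightarrow> \<exists>f\<in>\<Gamma>. h x < h (f y) \<and> (x, f y) \<in> (edges\<^sup>=) ^^ K"
    using uniform_path by blast
  define \<kappa> where "\<kappa> = p ^ K * (1 - p) ^ (K * \<Delta>)"
  \<comment> \<open>The weight loss \<open>\<kappa>\<close> of a gluing is moved to the other side,
    so its reciprocal joins the constants of the fibre bound.\<close>
  define b where "b = Suc K * 2 ^ (Suc \<Delta> ^ K) * card A / \<kappa>"
  have \<kappa>: "0 < \<kappa>" "\<kappa> \<le> 1" using p by (auto simp: \<kappa>_def intro!: mult_le_one power_le_one)
  have "0 < card A" using root_finite root_nonempty by (simp add: card_gt_0_iff)
  then have "1 \<le> Suc K * 2 ^ (Suc \<Delta> ^ K) * card A" by (simp add: Suc_le_eq)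
  then have "1 \<le> real (Suc K * 2 ^ (Suc \<Delta> ^ K) * card A)" by linarith
  then have b: "1 \<le> b" unfolding b_def using \<kappa> by (subst le_divide_eq_1_pos) auto
  \<comment> \<open>The fibre bound is quadratic in \<open>m\<close>, hence subexponential. The
    summand 1 inside the square keeps the bound at least 1 even for
    \<open>m = K = 0\<close>.\<close>
  show ?thesis
  proof (rule root_convergent_if_supermultiplicative[where M = "\<lambda>m. b * (real m + real K + 1)\<^sup>2" and K = K
        and c = "p * (1 - p) ^ \<Delta>"])
    show "1 \<le> b * (real m + real K + 1)\<^sup>2" for m
    proof -
      have "1 * 1 \<le> b * (real m + real K + 1)\<^sup>2" using b by (intro mult_mono) auto
      then show ?thesis by simp
    qed
    show "(\<lambda>m. ln (b * (real m + real K + 1)\<^sup>2) / real m) \<longlonglongrightarrow> 0" using b by real_asymp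
    show "Q p n * Q p m \<le> b * (real m + real K + 1)\<^sup>2 * (\<Sum>k\<le>K. Q p (n + m + k))" for n m
    proof -
      have nn: "0 \<le> (\<Sum>k\<le>K. Q p (n + m + k))" using p by (intro sum_nonneg Q_nonneg) auto
      have "\<kappa> * (Q p n * Q p m) \<le> \<kappa> * b * (real (m + K))\<^sup>2 * (\<Sum>k\<le>K. Q p (n + m + k))"
      proof -
        have \<kappa>b: "\<kappa> * b = real (Suc K * 2 ^ (Suc \<Delta> ^ K) * card A)" using \<kappa> by (simp add: b_def)
        have "real (Suc K * ((m + K) * 2 ^ (Suc \<Delta> ^ K) * (card A * (m + K)))) = \<kappa> * b * (real (m + K))\<^sup>2"
          unfolding \<kappa>b by (simp only: of_nat_mult power2_eq_square mult_ac)
        then show ?thesis using Q_glue[OF \<Delta> K p, of n m] by (simp only: \<kappa>_def)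
      qed
      also have "\<dots> \<le> \<kappa> * b * (real m + real K + 1)\<^sup>2 * (\<Sum>k\<le>K. Q p (n + m + k))"
        using nn \<kappa> b by (intro mult_right_mono mult_left_mono power_mono) auto
      finally show ?thesis using \<kappa> by (simp add: mult.assoc)
    qed
    show "p * (1 - p) ^ \<Delta> \<le> 1" using p by (intro mult_le_one power_le_one) auto
    show "p * (1 - p) ^ \<Delta> * Q p n \<le> real (n + 1) * Q p (n + 1)" for n
      using Q_pad[OF \<Delta> p, of n] by simp
  qed (use p le1 Q_pos in auto)
qed

lemma growth_continuous:
  assumes le1: "\<And>p n. p \<in> {0<..<1} \<Longrightarrow> 0 < n \<Longrightarrow> Q p n \<le> 1"
  shows "continuous_on {0<..<1} (\<lambda>p. lim (\<lambda>n. root n (Q p n)))"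
proof -
  obtain \<Delta> where \<Delta>: "\<And>v. v \<in> V \<Longrightarrow> card (nbrs v) \<le> \<Delta>" using degree_bound by blast
  have lim: "(\<lambda>n. root n (Q p n)) \<longlonglongrightarrow> lim (\<lambda>n. root n (Q p n))" if "p \<in> {0<..<1}" for p
    using root_Q_convergent le1 that by (simp add: convergent_LIMSEQ_iff)
  show ?thesis
  proof (rule ratio_continuous_on[where \<Delta> = \<Delta>])
    fix p q :: real assume p: "p \<in> {0<..<1}" and q: "q \<in> {0<..<1}"
    let ?g = "q / p * min 1 ((1 - q) / (1 - p)) ^ \<Delta>"
    have g: "0 \<le> ?g" using p q by auto
    show "lim (\<lambda>n. root n (Q p n)) * ?g \<le> lim (\<lambda>n. root n (Q q n))"
    proof (rule tendsto_le[OF sequentially_bot lim[OF q] tendsto_mult[OF lim[OF p] tendsto_const]])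
      \<comment> \<open>The \<open>n\<close>-th root turns the factor \<open>?g ^ n\<close> of
        \<open>Q_ratio\<close> into \<open>?g\<close>, independently of \<open>n\<close>.\<close>
      show "eventually (\<lambda>n. root n (Q p n) * ?g \<le> root n (Q q n)) sequentially"
        using eventually_gt_at_top[of 0]
      proof eventually_elim
        case (elim n)
        have "root n (Q p n) * ?g = root n (Q p n * ?g ^ n)"
          using elim g by (simp add: real_root_mult real_root_power_cancel)
        also have "\<dots> \<le> root n (Q q n)"
          using elim p q by (intro real_root_le_mono Q_ratio[OF \<Delta>]) auto
        finally show ?case .
      qed
    qed
  qed
qed

section \<open>Open clusters of the root set and their probabilities\<close>

definition cluster :: "('a \<Rightarrow> bool) \<Rightarrow> 'a set" where
  "cluster \<omega> = {y. \<exists>a\<in>A. \<omega> a \<and> (a, y) \<in> {(u, v). u \<in> V \<and> v \<in> V \<and> adj u v \<and> \<omega> u \<and> \<omega> v}\<^sup>*}"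

lemma cluster_step:
  assumes "u \<in> cluster \<omega>" "v \<in> V" "adj u v" "\<omega> v"
  shows "v \<in> cluster \<omega>"
proof -
  obtain a where a: "a \<in> A" "\<omega> a" "(a, u) \<in> {(u, v). u \<in> V \<and> v \<in> V \<and> adj u v \<and> \<omega> u \<and> \<omega> v}\<^sup>*"
    using assms by (auto simp: cluster_def)
  from a(3) have "u \<in> V \<and> \<omega> u" by (induction rule: rtrancl_induct) (use a root_subset in auto)
  then have "(a, v) \<in> {(u, v). u \<in> V \<and> v \<in> V \<and> adj u v \<and> \<omega> u \<and> \<omega> v}\<^sup>*"
    using a assms by (auto intro: rtrancl_into_rtrancl)
  with a show ?thesis by (auto simp: cluster_def)
qed

lemma root_in_cluster: "a \<in> A \<Longrightarrow> \<omega> a \<Longrightarrow> a \<in> cluster \<omega>"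
  by (auto simp: cluster_def)

lemma cluster_induct [consumes 1, case_names root step]:
  assumes "y \<in> cluster \<omega>"
    and "\<And>a. a \<in> A \<Longrightarrow> \<omega> a \<Longrightarrow> P a"
    and "\<And>u v. u \<in> cluster \<omega> \<Longrightarrow> P u \<Longrightarrow> v \<in> V \<Longrightarrow> adj u v \<Longrightarrow> \<omega> v \<Longrightarrow> P v"
  shows "P y"
proof -
  obtain a where a: "a \<in> A" "\<omega> a" "(a, y) \<in> {(u, v). u \<in> V \<and> v \<in> V \<and> adj u v \<and> \<omega> u \<and> \<omega> v}\<^sup>*"
    using assms(1) by (auto simp: cluster_def)
  from a(3) have "y \<in> cluster \<omega> \<and> P y"
  proof (induction rule: rtrancl_induct)
    case base
    then show ?case using a assms root_in_cluster by blast
  next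
    case (step u v)
    then show ?case using assms(3) cluster_step by blast
  qed
  then show ?thesis ..
qed

lemma cluster_open: "v \<in> cluster \<omega> \<Longrightarrow> v \<in> V \<and> \<omega> v"
  by (induction rule: cluster_induct) (use root_subset in auto)

lemma cluster_boundary_closed: "v \<in> boundary (cluster \<omega>) \<Longrightarrow> \<not> \<omega> v"
  using cluster_step by (auto simp: boundary_def)

text \<open>Every point is joined inside the cluster to an open root, and distinct open roots are
  adjacent to each other.\<close>

lemma cluster_linked: "linked (cluster \<omega>)"
proof -
  have *: "\<exists>a\<in>A \<inter> cluster \<omega>. (a, x) \<in> (links (cluster \<omega>))\<^sup>*" if "x \<in> cluster \<omega>" for x
    using that
  proof (induction rule: cluster_induct)
    case (root a)
    then show ?case using root_in_cluster by blast
  next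
    case (step u v)
    then have "(u, v) \<in> links (cluster \<omega>)" using cluster_step by (auto simp: links_def)
    with step show ?case by (meson rtrancl.rtrancl_into_rtrancl)
  qed
  show ?thesis unfolding linked_def
  proof (intro ballI)
    fix x y assume "x \<in> cluster \<omega>" "y \<in> cluster \<omega>"
    then obtain a b where ab: "a \<in> A \<inter> cluster \<omega>" "b \<in> A \<inter> cluster \<omega>"
      "(a, x) \<in> (links (cluster \<omega>))\<^sup>*" "(b, y) \<in> (links (cluster \<omega>))\<^sup>*" using * by meson
    then have "(a, b) \<in> (links (cluster \<omega>))\<^sup>*"
      using root_clique[of a b] by (cases "a = b") (auto simp: links_def)
    with ab show "(x, y) \<in> (links (cluster \<omega>))\<^sup>*" using links_sym rtrancl_trans by metis
  qed
qed

lemma cluster_animal: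
  assumes "finite (cluster \<omega>)" "card (cluster \<omega>) = n" "0 < n"
  shows "cluster \<omega> \<in> animals n"
proof -
  have "cluster \<omega> \<noteq> {}" using assms by auto
  then have "cluster \<omega> \<inter> A \<noteq> {}" using root_in_cluster by (auto simp: cluster_def)
  then show ?thesis using assms cluster_linked cluster_open by (auto simp: animals_def)
qed

text \<open>Links inside \<open>C\<close> stay open, which gives one inclusion. For the other, an
  open path leaving \<open>C\<close> would have to enter the closed boundary.\<close>

lemma cluster_eq:
  assumes C: "C \<in> animals n" and op: "\<And>v. v \<in> C \<Longrightarrow> \<omega> v" and cl: "\<And>v. v \<in> boundary C \<Longrightarrow> \<not> \<omega> v"
  shows "cluster \<omega> = C"
proof
  obtain a where a: "a \<in> A" "a \<in> C" using animalsD[OF C] by blast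
  show "C \<subseteq> cluster \<omega>"
  proof
    fix x assume "x \<in> C"
    then have "(a, x) \<in> (links C)\<^sup>*" using animalsD[OF C] a by (auto simp: linked_def)
    then show "x \<in> cluster \<omega>"
    proof (induction rule: rtrancl_induct)
      case base
      then show ?case using a op root_in_cluster by blast
    next
      case (step u v)
      then show ?case using cluster_step op animalsD(1)[OF C] by (auto simp: links_def)
    qed
  qed
  show "cluster \<omega> \<subseteq> C"
  proof
    fix x assume "x \<in> cluster \<omega>"
    then show "x \<in> C"
    proof (induction rule: cluster_induct)
      case (root b)
      \<comment> \<open>A root outside \<open>C\<close> is adjacent to the root \<open>a\<close> in
        \<open>C\<close>, so it is a boundary point and therefore closed.\<close>
      have "b \<in> boundary C" if "b \<notin> C"
        using a that root(1) root_clique[OF a(1) root(1)] root_subset by (auto simp: boundary_def)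
      then show ?case using cl root(2) by blast
    next
      case (step u v)
      have "v \<in> boundary C" if "v \<notin> C" using step that by (auto simp: boundary_def)
      then show ?case using cl step by blast
    qed
  qed
qed

text \<open>The event constrains only the finitely many coordinates in \<open>C\<close> and its
  boundary, so its measure is a finite product.\<close>

lemma prob_cylinder:
  assumes C: "C \<in> animals n" and p: "0 \<le> p" "p \<le> 1"
  defines "M \<equiv> PiM V (\<lambda>_. measure_pmf (bernoulli_pmf p))"
  defines "Y \<equiv> {\<omega> \<in> space M. (\<forall>v\<in>C. \<omega> v) \<and> (\<forall>v\<in>boundary C. \<not> \<omega> v)}"
  shows "Y \<in> sets M" "measure M Y = weight p C"
proof -
  interpret product_prob_space "\<lambda>_. measure_pmf (bernoulli_pmf p)" V
    by unfold_locales
  define X where "X v = (if v \<in> C then {True} else {False})" for v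
  define J where "J = C \<union> boundary C"
  have J: "finite J" "J \<subseteq> V" using animalsD[OF C] finite_boundary by (auto simp: J_def boundary_def)
  have disj: "v \<notin> C" if "v \<in> boundary C" for v using that by (simp add: boundary_def)
  have Y: "Y = emb V J (Pi\<^sub>E J X)"
    using J disj unfolding Y_def M_def prod_emb_def space_PiM
    by (fastforce simp: X_def J_def PiE_iff extensional_def split: if_splits)
  show "Y \<in> sets M" unfolding Y M_def using J by (intro sets_PiM_I) auto
  have "measure M Y = (\<Prod>v\<in>J. measure (measure_pmf (bernoulli_pmf p)) (X v))"
    unfolding Y M_def using J by (intro measure_PiM_emb) auto
  also have "\<dots> = (\<Prod>v\<in>J. if v \<in> C then p else 1 - p)"
    using p by (intro prod.cong) (auto simp: X_def measure_pmf_single)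
  also have "\<dots> = weight p C"
  proof -
    have "(\<Prod>v\<in>boundary C. if v \<in> C then p else 1 - p) = (\<Prod>v\<in>boundary C. 1 - p)"
      using disj by (intro prod.cong) auto
    moreover have "(\<Prod>v\<in>C. if v \<in> C then p else 1 - p) = (\<Prod>v\<in>C. p)" by (intro prod.cong) auto
    moreover have "C \<inter> boundary C = {}" using disj by blast
    ultimately show ?thesis unfolding J_def using animalsD(2)[OF C] finite_boundary[OF animalsD(2,1)[OF C]]
      by (simp add: prod.union_disjoint weight_def)
  qed
  finally show "measure M Y = weight p C" .
qed

text \<open>The event splits according to the value of the cluster into finitely many disjoint
  cylinders. Size 0 is excluded because the empty cluster is not an animal.\<close>

lemma prob_cluster_card:
  assumes n: "0 < n" and p: "0 \<le> p" "p \<le> 1"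
  defines "M \<equiv> PiM V (\<lambda>_. measure_pmf (bernoulli_pmf p))"
  shows "measure M {\<omega> \<in> space M. finite (cluster \<omega>) \<and> card (cluster \<omega>) = n} = Q p n"
proof -
  interpret product_prob_space "\<lambda>_. measure_pmf (bernoulli_pmf p)" V
    by unfold_locales
  define Y where "Y C = {\<omega> \<in> space M. (\<forall>v\<in>C. \<omega> v) \<and> (\<forall>v\<in>boundary C. \<not> \<omega> v)}" for C
  have cluster_Y: "cluster \<omega> = C" if "C \<in> animals n" "\<omega> \<in> Y C" for C \<omega>
    using cluster_eq[OF that(1), of \<omega>] that(2) by (simp add: Y_def)
  have "{\<omega> \<in> space M. finite (cluster \<omega>) \<and> card (cluster \<omega>) = n} = (\<Union>C\<in>animals n. Y C)"
    (is "?L = ?R")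
  proof
    show "?L \<subseteq> ?R"
    proof
      fix \<omega> assume "\<omega> \<in> ?L"
      then show "\<omega> \<in> ?R"
        using n by (intro UN_I[of "cluster \<omega>"])
          (auto simp: Y_def intro!: cluster_animal dest: cluster_open cluster_boundary_closed)
    qed
    show "?R \<subseteq> ?L"
    proof
      fix \<omega> assume "\<omega> \<in> ?R"
      then obtain C where C: "C \<in> animals n" "\<omega> \<in> Y C" by blast
      then have "cluster \<omega> = C" by (rule cluster_Y)
      with C show "\<omega> \<in> ?L" using animalsD[OF C(1)] by (auto simp: Y_def)
    qed
  qed
  moreover have "disjoint_family_on Y (animals n)"
    unfolding disjoint_family_on_def
  proof (intro ballI impI)
    fix C D assume CD: "C \<in> animals n" "D \<in> animals n" "C \<noteq> D"
    show "Y C \<inter> Y D = {}"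
    proof (rule ccontr)
      assume "\<not> ?thesis"
      then obtain \<omega> where "\<omega> \<in> Y C" "\<omega> \<in> Y D" by blast
      then have "cluster \<omega> = C" "cluster \<omega> = D" using CD cluster_Y by blast+
      with CD show False by simp
    qed
  qed
  moreover have "Y C \<in> sets M" "measure M (Y C) = weight p C" if "C \<in> animals n" for C
    using prob_cylinder[OF that p] by (auto simp: Y_def M_def)
  ultimately show ?thesis
    unfolding Q_def
    by (simp add: measure_finite_Union finite_animals M_def image_subset_iff P.emeasure_eq_measure cong: sum.cong)
qed

theorem cluster_growth_continuous:
  defines "M \<equiv> \<lambda>p. PiM V (\<lambda>_. measure_pmf (bernoulli_pmf p))"
  shows "continuous_on {0<..<1} (\<lambda>p. lim (\<lambda>n. root n
    (measure (M p) {\<omega> \<in> space (M p). finite (cluster \<omega>) \<and> card (cluster \<omega>) = n})))"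
proof -
  have eq: "measure (M p) {\<omega> \<in> space (M p). finite (cluster \<omega>) \<and> card (cluster \<omega>) = n} = Q p n"
    if "0 < n" "p \<in> {0<..<1}" for n p
    using prob_cluster_card[of n p] that by (simp add: M_def)
  have "Q p n \<le> 1" if "p \<in> {0<..<1}" "0 < n" for n p
  proof -
    interpret product_prob_space "\<lambda>_. measure_pmf (bernoulli_pmf p)" V
      by unfold_locales
    have "measure (M p) {\<omega> \<in> space (M p). finite (cluster \<omega>) \<and> card (cluster \<omega>) = n} \<le> 1"
      unfolding M_def by (rule P.prob_le_1)
    then show ?thesis using eq[OF that(2,1)] by simp
  qed
  then have "continuous_on {0<..<1} (\<lambda>p. lim (\<lambda>n. root n (Q p n)))" by (rule growth_continuous)
  \<comment> \<open>At \<open>n = 0\<close> the probability and \<open>Q\<close> may differ, but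
    \<open>root 0\<close> is 0 by convention.\<close>
  moreover have "root n (measure (M p) {\<omega> \<in> space (M p). finite (cluster \<omega>) \<and> card (cluster \<omega>) = n}) =
      root n (Q p n)" if "p \<in> {0<..<1}" for n p
    using eq[OF _ that, of n] by (cases "n = 0") auto
  ultimately show ?thesis by (simp cong: continuous_on_cong_simp)
qed

end

section \<open>Site and bond percolation on a periodic lattice\<close>

text \<open>The condition \<open>no_involution\<close> prevents a map from swapping the ends of an
  edge; this keeps the induced action on edges free.\<close>

locale periodic_lattice = periodic_graph V "\<lambda>u v. {u, v} \<in> E" \<Gamma> h
  for V :: "'a set" and E :: "'a set set" and \<Gamma> and h +
  assumes simple: "simple_graph V E"
    and no_involution: "f \<in> \<Gamma> \<Longrightarrow> v \<in> V \<Longrightarrow> f (f v) = v \<Longrightarrow> f v = v"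
begin

lemma edgeE:
  assumes "e \<in> E"
  obtains x y where "x \<in> V" "y \<in> V" "x \<noteq> y" "e = {x, y}"
  using simple assms unfolding simple_graph_def by blast

lemma edge_subset: "e \<in> E \<Longrightarrow> e \<subseteq> V"
  by (auto elim: edgeE)

lemma image_edge:
  assumes "f \<in> \<Gamma>" "e \<in> E"
  shows "f ` e \<in> E"
proof -
  obtain x y where "x \<in> V" "y \<in> V" "e = {x, y}" using edgeE[OF assms(2)] by blast
  then show ?thesis using adj_iff[OF assms(1), of x y] assms(2) by simp
qed

lemma finite_star: "x \<in> V \<Longrightarrow> finite {e \<in> E. x \<in> e}"
proof (rule finite_subset)
  assume x: "x \<in> V"
  show "finite ((\<lambda>y. {x, y}) ` {y \<in> V. {x, y} \<in> E})" using finite_nbrs[OF x] by simp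
  show "{e \<in> E. x \<in> e} \<subseteq> (\<lambda>y. {x, y}) ` {y \<in> V. {x, y} \<in> E}"
  proof
    fix e assume e: "e \<in> {e \<in> E. x \<in> e}"
    then obtain u v where uv: "u \<in> V" "v \<in> V" "e = {u, v}" by (auto elim: edgeE)
    then have "e = {x, v} \<or> e = {x, u}" using e by auto
    then show "e \<in> (\<lambda>y. {x, y}) ` {y \<in> V. {x, y} \<in> E}" using uv e by blast
  qed
qed

lemma star_nonempty:
  assumes "x \<in> V"
  shows "{e \<in> E. x \<in> e} \<noteq> {}"
proof -
  obtain f where f: "f \<in> \<Gamma>" "h x < h (f x)" using exists_higher[OF assms] by blast
  from connected[OF assms maps_to[OF f(1) assms]] show ?thesis
    by (cases rule: converse_rtranclE) (use f in auto)
qed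

text \<open>Freeness of the action on edges. Maps with the same image of an edge either agree at an
  endpoint or differ by a swap of the endpoints.\<close>

lemma image_eq_imp_eq:
  assumes f: "f \<in> \<Gamma>" and g: "g \<in> \<Gamma>" and e: "e \<in> E" "f ` e = g ` e" and v: "v \<in> V"
  shows "f v = g v"
proof -
  obtain x y where xy: "x \<in> V" "y \<in> V" "x \<noteq> y" "e = {x, y}" using edgeE[OF e(1)] by blast
  have "f x \<noteq> f y" using inj[OF f] xy by (auto simp: inj_on_def)
  then consider "f x = g x" | "f x = g y" "f y = g x" using e(2) xy(4) by (auto simp: doubleton_eq_iff)
  then show ?thesis
  proof cases
    case 1
    then show ?thesis using free[OF f g xy(1) _ v] by simp
  next
    case 2
    \<comment> \<open>The composite \<open>l\<close> of \<open>f\<close> with the inverse of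
      \<open>g\<close> sends \<open>x\<close> to \<open>y\<close> and back, which
      \<open>no_involution\<close> forbids.\<close>
    obtain k where k: "k \<in> \<Gamma>" "\<forall>v\<in>V. k (g v) = v" using left_inverse[OF g] by blast
    obtain l where l: "l \<in> \<Gamma>" "\<forall>v\<in>V. l v = k (f v)" using comp[OF k(1) f] by blast
    have "l (l x) = x" "l x = y" using 2 k l xy by simp_all
    then show ?thesis using no_involution[OF l(1) xy(1)] xy(3) by simp
  qed
qed

lemma sum_height_image:
  assumes f: "f \<in> \<Gamma>" and c: "\<forall>v\<in>V. h (f v) = h v + c" and e: "e \<in> E"
  shows "sum h (f ` e) = sum h e + 2 * c"
proof -
  obtain x y where xy: "x \<in> V" "y \<in> V" "x \<noteq> y" "e = {x, y}" using edgeE[OF e] by blast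
  then have "f x \<noteq> f y" using inj[OF f] by (auto simp: inj_on_def)
  then show ?thesis using xy c by simp
qed

text \<open>Along a vertex path from \<open>x\<close> to \<open>y\<close>, all edges at the current
  vertex are reachable from \<open>e\<close>.\<close>

lemma line_graph_connected:
  assumes "e \<in> E" "e' \<in> E"
  shows "(e, e') \<in> {(u, v). u \<in> E \<and> v \<in> E \<and> u \<inter> v \<noteq> {}}\<^sup>*" (is "_ \<in> ?L\<^sup>*")
proof -
  obtain x where x: "x \<in> e" "x \<in> V" using edgeE[OF assms(1)] by blast
  obtain y where y: "y \<in> e'" "y \<in> V" using edgeE[OF assms(2)] by blast
  from connected[OF x(2) y(2)] have "\<forall>e'\<in>E. y \<in> e' \<longrightarrow> (e, e') \<in> ?L\<^sup>*"
  proof (induction rule: rtrancl_induct)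
    case base
    show ?case using assms(1) x by (blast intro: r_into_rtrancl)
  next
    case (step z w)
    show ?case
    proof (intro ballI impI)
      fix e' assume "e' \<in> E" "w \<in> e'"
      then have "({z, w}, e') \<in> ?L" using step by auto
      moreover have "(e, {z, w}) \<in> ?L\<^sup>*" using step by auto
      ultimately show "(e, e') \<in> ?L\<^sup>*" by (rule rtrancl_into_rtrancl[rotated])
    qed
  qed
  then show ?thesis using assms y by blast
qed

lemma image_inverse_edge:
  assumes "\<forall>v\<in>V. g (f v) = v" and "e \<in> E"
  shows "g ` f ` e = e"
proof -
  have "(\<lambda>x. g (f x)) ` e = (\<lambda>x. x) ` e"
    using assms(1) edge_subset[OF assms(2)] by (intro image_cong) auto
  then show ?thesis by (simp add: image_image)
qed

text \<open>The group acts on edges by images, and an edge has the sum of the heights of its ends as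
  height. The edges at orbit representatives of vertices represent all edge orbits, and all edges at
  \<open>v0\<close> meet each other.\<close>

lemma line_graph_rooted:
  assumes v0: "v0 \<in> V"
  shows "rooted_periodic_graph E (\<lambda>e e'. e \<inter> e' \<noteq> {}) ((\<lambda>f. (`) f) ` \<Gamma>) (sum h) {e \<in> E. v0 \<in> e}"
proof
  show "(e, e') \<in> {(u, v). u \<in> E \<and> v \<in> E \<and> u \<inter> v \<noteq> {}}\<^sup>*" if "e \<in> E" "e' \<in> E" for e e'
    using that by (rule line_graph_connected)
  show "finite {e' \<in> E. e \<inter> e' \<noteq> {}}" if e: "e \<in> E" for e
  proof (rule finite_subset)
    show "{e' \<in> E. e \<inter> e' \<noteq> {}} \<subseteq> (\<Union>x\<in>e. {e' \<in> E. x \<in> e'})" by blast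
    obtain x y where "x \<in> V" "y \<in> V" "e = {x, y}" using edgeE[OF e] by blast
    then show "finite (\<Union>x\<in>e. {e' \<in> E. x \<in> e'})" using finite_star by auto
  qed
  show "bij_betw F E E" if F: "F \<in> (\<lambda>f. (`) f) ` \<Gamma>" for F
  proof -
    obtain f where f: "f \<in> \<Gamma>" "F = (`) f" using F by blast
    obtain g where g: "g \<in> \<Gamma>" "\<forall>v\<in>V. g (f v) = v" "\<forall>v\<in>V. f (g v) = v"
      using two_sided_inverse[OF f(1)] by blast
    show ?thesis unfolding f(2)
      by (rule bij_betw_byWitness[where f' = "(`) g"])
        (use image_inverse_edge[where f = f and g = g, OF g(2)]
          image_inverse_edge[where f = g and g = f, OF g(3)] image_edge g(1) f(1) in auto)
  qed
  show "F u \<inter> F v \<noteq> {} \<longleftrightarrow> u \<inter> v \<noteq> {}" if F: "F \<in> (\<lambda>f. (`) f) ` \<Gamma>" and uv: "u \<in> E" "v \<in> E" for F u v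
  proof -
    obtain f where f: "f \<in> \<Gamma>" "F = (`) f" using F by blast
    have "f ` (u \<inter> v) = f ` u \<inter> f ` v"
      using inj_on_image_Int[OF inj[OF f(1)]] edge_subset uv by blast
    then show ?thesis unfolding f(2) by (metis image_is_empty)
  qed
  show "\<exists>K\<in>(\<lambda>f. (`) f) ` \<Gamma>. \<forall>e\<in>E. K e = F (G e)" if FG: "F \<in> (\<lambda>f. (`) f) ` \<Gamma>" "G \<in> (\<lambda>f. (`) f) ` \<Gamma>" for F G
  proof -
    obtain f g where f: "f \<in> \<Gamma>" "F = (`) f" and g: "g \<in> \<Gamma>" "G = (`) g" using FG by blast
    obtain k where k: "k \<in> \<Gamma>" "\<forall>v\<in>V. k v = f (g v)" using comp[OF f(1) g(1)] by blast
    have "k ` e = F (G e)" if "e \<in> E" for e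
      unfolding f(2) g(2) image_image using k(2) edge_subset[OF that] by (intro image_cong) auto
    then show ?thesis using k(1) by blast
  qed
  show "\<exists>G\<in>(\<lambda>f. (`) f) ` \<Gamma>. \<forall>e\<in>E. G (F e) = e" if F: "F \<in> (\<lambda>f. (`) f) ` \<Gamma>" for F
  proof -
    obtain f where f: "f \<in> \<Gamma>" "F = (`) f" using F by blast
    obtain g where g: "g \<in> \<Gamma>" "\<forall>v\<in>V. g (f v) = v" using left_inverse[OF f(1)] by blast
    have "\<forall>e\<in>E. (`) g (F e) = e" unfolding f(2) using image_inverse_edge[where f = f and g = g, OF g(2)] by blast
    then show ?thesis using g(1) by blast
  qed
  show "F v = G v" if FG: "F \<in> (\<lambda>f. (`) f) ` \<Gamma>" "G \<in> (\<lambda>f. (`) f) ` \<Gamma>"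
    and uv: "u \<in> E" "F u = G u" "v \<in> E" for F G u v
  proof -
    obtain f g where f: "f \<in> \<Gamma>" "F = (`) f" and g: "g \<in> \<Gamma>" "G = (`) g" using FG by blast
    have "f x = g x" if "x \<in> V" for x using image_eq_imp_eq[OF f(1) g(1) uv(1) _ that] uv(2) f g by simp
    then show ?thesis unfolding f(2) g(2) using edge_subset[OF uv(3)] by (intro image_cong) auto
  qed
  show "\<exists>c. \<forall>e\<in>E. sum h (F e) = sum h e + c" if F: "F \<in> (\<lambda>f. (`) f) ` \<Gamma>" for F
  proof -
    obtain f where f: "f \<in> \<Gamma>" "F = (`) f" using F by blast
    obtain c where "\<forall>v\<in>V. h (f v) = h v + c" using height[OF f(1)] by blast
    then show ?thesis unfolding f(2) using sum_height_image[OF f(1)] by blast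
  qed
  show "\<exists>F\<in>(\<lambda>f. (`) f) ` \<Gamma>. \<exists>c>0. \<forall>e\<in>E. sum h (F e) = sum h e + c"
  proof -
    obtain f c where f: "f \<in> \<Gamma>" "0 < c" "\<forall>v\<in>V. h (f v) = h v + c" using ascent by blast
    then have "\<forall>e\<in>E. sum h (f ` e) = sum h e + 2 * c" using sum_height_image by blast
    moreover have "0 < 2 * c" using f by simp
    ultimately show ?thesis using f(1) by blast
  qed
  show "\<exists>F. finite F \<and> F \<subseteq> E \<and> (\<forall>v\<in>E. \<exists>f\<in>(\<lambda>f. (`) f) ` \<Gamma>. \<exists>r\<in>F. v = f r)"
  proof -
    obtain F where F: "finite F" "F \<subseteq> V" "\<forall>v\<in>V. \<exists>f\<in>\<Gamma>. \<exists>r\<in>F. v = f r"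
      using finite_orbits by blast
    let ?F = "\<Union>r\<in>F. {e \<in> E. r \<in> e}"
    have "\<exists>f\<in>(\<lambda>f. (`) f) ` \<Gamma>. \<exists>r\<in>?F. e = f r" if e: "e \<in> E" for e
    proof -
      obtain x where x: "x \<in> V" "x \<in> e" using edgeE[OF e] by blast
      obtain f r where f: "f \<in> \<Gamma>" "r \<in> F" "x = f r" using bspec[OF F(3) x(1)] by blast
      obtain g where g: "g \<in> \<Gamma>" "\<forall>v\<in>V. g (f v) = v" "\<forall>v\<in>V. f (g v) = v"
        using two_sided_inverse[OF f(1)] by blast
      have "r = g x" using g(2) f F(2) by auto
      then have "g ` e \<in> ?F" using image_edge[OF g(1) e] f(2) x(2) by blast
      moreover have "e = f ` (g ` e)" using image_inverse_edge[where f = g and g = f, OF g(3) e] by simp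
      ultimately show ?thesis using f(1) by blast
    qed
    moreover have "finite ?F" using F finite_star by blast
    ultimately show ?thesis by (intro exI[of _ ?F]) auto
  qed
qed (use finite_star[OF v0] star_nonempty[OF v0] in auto)

lemma site_rooted:
  assumes "v0 \<in> V"
  shows "rooted_periodic_graph V (\<lambda>u v. {u, v} \<in> E) \<Gamma> h {v0}"
  by unfold_locales (use assms in auto)

lemma continuous_site_c:
  assumes v0: "v0 \<in> V"
  shows "continuous_on {0<..<1} (site_c V E v0)"
proof -
  interpret R: rooted_periodic_graph V "\<lambda>u v. {u, v} \<in> E" \<Gamma> h "{v0}" by (rule site_rooted[OF v0])
  have "a \<in> V \<and> b \<in> V" if "{a, b} \<in> E" for a b using edge_subset[OF that] by simp
  then have "{(a, b). {a, b} \<in> E \<and> \<omega> a \<and> \<omega> b} = {(u, v). u \<in> V \<and> v \<in> V \<and> {u, v} \<in> E \<and> \<omega> u \<and> \<omega> v}" for \<omega>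
    by blast
  then have "R.cluster \<omega> = site_cluster E \<omega> v0" for \<omega>
    unfolding R.cluster_def site_cluster_def by auto
  then show ?thesis
    using R.cluster_growth_continuous unfolding site_c_def[abs_def] site_prob_def site_space_def by simp
qed

text \<open>Open paths of edges in the line graph that start in the star of \<open>v0\<close> sweep
  out exactly the edges of the bond cluster, so the result for rooted graphs applies to the line
  graph.\<close>

lemma continuous_bond_c:
  assumes v0: "v0 \<in> V"
  shows "continuous_on {0<..<1} (bond_c E v0)"
proof -
  interpret R: rooted_periodic_graph E "\<lambda>e e'. e \<inter> e' \<noteq> {}" "(\<lambda>f. (`) f) ` \<Gamma>" "sum h" "{e \<in> E. v0 \<in> e}"
    by (rule line_graph_rooted[OF v0])
  have "R.cluster \<omega> = bond_cluster_edges E \<omega> v0" for \<omega>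
  proof
    let ?R = "{(a, b). {a, b} \<in> E \<and> \<omega> {a, b}}"
    have reach: "e \<subseteq> bond_cluster_vertices E \<omega> v0"
      if e: "e \<in> E" "\<omega> e" "x \<in> e" "(v0, x) \<in> ?R\<^sup>*" for e x
    proof
      fix y assume y: "y \<in> e"
      obtain a b where "e = {a, b}" using edgeE[OF e(1)] by blast
      then have "x = y \<or> e = {x, y}" using e(3) y by auto
      then have "(x, y) \<in> ?R\<^sup>*" using e by auto
      then show "y \<in> bond_cluster_vertices E \<omega> v0"
        using e(4) by (auto simp: bond_cluster_vertices_def)
    qed
    show "R.cluster \<omega> \<subseteq> bond_cluster_edges E \<omega> v0"
    proof
      fix e assume "e \<in> R.cluster \<omega>"
      then have "e \<in> E \<and> \<omega> e \<and> e \<subseteq> bond_cluster_vertices E \<omega> v0"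
      proof (induction rule: R.cluster_induct)
        case (root a)
        then show ?case using reach[of a v0] by auto
      next
        case (step u v)
        then obtain x where x: "x \<in> u" "x \<in> v" by blast
        then have "(v0, x) \<in> ?R\<^sup>*" using step by (auto simp: bond_cluster_vertices_def)
        then show ?case using reach[of v x] step x by blast
      qed
      then show "e \<in> bond_cluster_edges E \<omega> v0" by (simp add: bond_cluster_edges_def)
    qed
    \<comment> \<open>Stated for all open edges at \<open>x\<close>, so that the induction can pass
      from the edge just traversed to any open edge at its far end.\<close>
    have star: "\<forall>e\<in>E. \<omega> e \<longrightarrow> x \<in> e \<longrightarrow> e \<in> R.cluster \<omega>" if "(v0, x) \<in> ?R\<^sup>*" for x
      using that
    proof (induction rule: rtrancl_induct)
      case base
      then show ?case using R.root_in_cluster by blast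
    next
      case (step z w)
      then have "{z, w} \<in> R.cluster \<omega>" by auto
      then show ?case using R.cluster_step by blast
    qed
    show "bond_cluster_edges E \<omega> v0 \<subseteq> R.cluster \<omega>"
    proof
      fix e assume e: "e \<in> bond_cluster_edges E \<omega> v0"
      then have "e \<in> E" by (simp add: bond_cluster_edges_def)
      then obtain x where "x \<in> e" by (auto elim: edgeE)
      then show "e \<in> R.cluster \<omega>"
        using e star[of x] by (auto simp: bond_cluster_edges_def bond_cluster_vertices_def)
    qed
  qed
  then show ?thesis
    using R.cluster_growth_continuous unfolding bond_c_def[abs_def] bond_prob_def bond_space_def by simp
qed

end

section \<open>Transport of the periodic structure along a graph isomorphism\<close>

lemma periodic_lattice_iso:
  fixes V :: "'a set" and V' :: "'b set"
  assumes iso: "graph_iso \<phi> V E V' E'" and simple: "simple_graph V E"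
    and L: "periodic_lattice V' E' \<Gamma> h"
  shows "\<exists>\<Gamma> h. periodic_lattice V E \<Gamma> h"
proof -
  interpret L: periodic_lattice V' E' \<Gamma> h by (rule L)
  define \<psi> where "\<psi> = inv_into V \<phi>"
  have bij: "bij_betw \<phi> V V'" using iso by (simp add: graph_iso_def)
  have E: "{x, y} \<in> E \<longleftrightarrow> {\<phi> x, \<phi> y} \<in> E'" if "x \<in> V" "y \<in> V" for x y
    using iso that by (simp add: graph_iso_def)
  have \<phi>: "\<phi> x \<in> V'" if "x \<in> V" for x using bij_betw_apply[OF bij that] .
  have \<psi>: "\<psi> y \<in> V" "\<phi> (\<psi> y) = y" if "y \<in> V'" for y
    using bij that unfolding \<psi>_def by (auto simp: bij_betw_def inv_into_into f_inv_into_f)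
  have \<psi>\<phi>: "\<psi> (\<phi> x) = x" if "x \<in> V" for x
    using bij that unfolding \<psi>_def by (auto simp: bij_betw_def)
  have \<psi>E: "{\<psi> x, \<psi> y} \<in> E \<longleftrightarrow> {x, y} \<in> E'" if "x \<in> V'" "y \<in> V'" for x y
    using E \<psi> that by simp
  have \<psi>_eq: "\<psi> x = \<psi> y \<longleftrightarrow> x = y" if "x \<in> V'" "y \<in> V'" for x y
    using \<psi> that by metis
  \<comment> \<open>The group is conjugated by the isomorphism and the height is pulled back; the
    laws then hold on \<open>V\<close>, where \<open>\<psi>\<close> inverts
    \<open>\<phi>\<close>.\<close>
  define T where "T f x = \<psi> (f (\<phi> x))" for f x
  have T: "T f x \<in> V" "\<phi> (T f x) = f (\<phi> x)" if "f \<in> \<Gamma>" "x \<in> V" for f x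
    using \<psi> L.maps_to \<phi> that by (simp_all add: T_def)
  have T_eq: "T f x = T g y \<longleftrightarrow> f (\<phi> x) = g (\<phi> y)" if "f \<in> \<Gamma>" "g \<in> \<Gamma>" "x \<in> V" "y \<in> V" for f g x y
    unfolding T_def using \<psi>_eq L.maps_to \<phi> that by simp
  have "periodic_lattice V E (T ` \<Gamma>) (h \<circ> \<phi>)"
  proof
    fix u v assume uv: "u \<in> V" "v \<in> V"
    have "(\<phi> u, \<phi> v) \<in> {(x, y). x \<in> V' \<and> y \<in> V' \<and> {x, y} \<in> E'}\<^sup>*"
      using L.connected \<phi> uv by blast
    then have "(\<psi> (\<phi> u), \<psi> (\<phi> v)) \<in> {(x, y). x \<in> V \<and> y \<in> V \<and> {x, y} \<in> E}\<^sup>*"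
    proof (induction rule: rtrancl_induct)
      case (step y z)
      then have "(\<psi> y, \<psi> z) \<in> {(x, y). x \<in> V \<and> y \<in> V \<and> {x, y} \<in> E}" using \<psi> \<psi>E by auto
      with step show ?case by (meson rtrancl_into_rtrancl)
    qed simp
    then show "(u, v) \<in> {(x, y). x \<in> V \<and> y \<in> V \<and> {x, y} \<in> E}\<^sup>*" using \<psi>\<phi> uv by simp
  next
    fix u assume u: "u \<in> V"
    have "{v \<in> V. {u, v} \<in> E} \<subseteq> \<psi> ` {v \<in> V'. {\<phi> u, v} \<in> E'}"
      using E \<phi> \<psi>\<phi> u by (force simp: image_iff)
    then show "finite {v \<in> V. {u, v} \<in> E}"
      using L.finite_nbrs[OF \<phi>[OF u]] finite_surj by blast
  next
    fix F assume "F \<in> T ` \<Gamma>"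
    then obtain f where f: "f \<in> \<Gamma>" "F = T f" by blast
    obtain g where g: "g \<in> \<Gamma>" "\<forall>v\<in>V'. g (f v) = v" "\<forall>v\<in>V'. f (g v) = v"
      using L.two_sided_inverse[OF f(1)] by blast
    have gf: "T g (T f x) = x" "T f (T g x) = x" if "x \<in> V" for x
      using that f g T \<phi> \<psi>\<phi> by (simp_all add: T_def[of _ "T _ _"])
    show "bij_betw F V V" unfolding f(2)
      by (rule bij_betw_byWitness[where f' = "T g"]) (use gf T f(1) g(1) in auto)
    show "\<exists>G\<in>T ` \<Gamma>. \<forall>v\<in>V. G (F v) = v" using gf f g(1) by blast
    show "{F u, F v} \<in> E \<longleftrightarrow> {u, v} \<in> E" if "u \<in> V" "v \<in> V" for u v
      unfolding f(2) using E T f(1) \<phi> L.adj_iff[OF f(1)] that by simp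
    show "\<exists>c. \<forall>v\<in>V. (h \<circ> \<phi>) (F v) = (h \<circ> \<phi>) v + c"
      using L.height[OF f(1)] T[OF f(1)] \<phi> unfolding f(2) by (metis comp_apply)
    show "F v = v" if "v \<in> V" "F (F v) = v" for v
    proof -
      have "\<phi> (T f (T f v)) = \<phi> v" using that f(2) by simp
      then have "f (f (\<phi> v)) = \<phi> v" using T[OF f(1)] that(1) by simp
      then have "f (\<phi> v) = \<phi> v" using L.no_involution[OF f(1)] \<phi> that(1) by simp
      then show ?thesis using \<psi>\<phi> that(1) by (simp add: f(2) T_def)
    qed
    fix G assume "G \<in> T ` \<Gamma>"
    then obtain g where g: "g \<in> \<Gamma>" "G = T g" by blast
    show "\<exists>K\<in>T ` \<Gamma>. \<forall>v\<in>V. K v = F (G v)"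
    proof -
      obtain k where k: "k \<in> \<Gamma>" "\<forall>v\<in>V'. k v = f (g v)" using L.comp[OF f(1) g(1)] by blast
      have "T k v = F (G v)" if "v \<in> V" for v
        using T(2)[OF g(1) that] k(2) \<phi>[OF that] unfolding f(2) g(2) by (simp add: T_def)
      then show ?thesis using k(1) by blast
    qed
    show "F v = G v" if "u \<in> V" "F u = G u" "v \<in> V" for u v
    proof -
      have "f (\<phi> u) = g (\<phi> u)" using that T_eq f g by simp
      then have "f (\<phi> v) = g (\<phi> v)" using L.free[OF f(1) g(1)] \<phi> that by blast
      then show ?thesis by (simp add: f g T_def)
    qed
  next
    show "\<exists>f\<in>T ` \<Gamma>. \<exists>c>0. \<forall>v\<in>V. (h \<circ> \<phi>) (f v) = (h \<circ> \<phi>) v + c"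
    proof -
      obtain f c where f: "f \<in> \<Gamma>" "0 < c" "\<forall>v\<in>V'. h (f v) = h v + c" using L.ascent by blast
      then have "\<forall>v\<in>V. (h \<circ> \<phi>) (T f v) = (h \<circ> \<phi>) v + c" using T \<phi> by simp
      with f show ?thesis by blast
    qed
  next
    obtain F where F: "finite F" "F \<subseteq> V'" "\<forall>v\<in>V'. \<exists>f\<in>\<Gamma>. \<exists>r\<in>F. v = f r"
      using L.finite_orbits by blast
    have "\<exists>f\<in>T ` \<Gamma>. \<exists>r\<in>\<psi> ` F. v = f r" if v: "v \<in> V" for v
    proof -
      obtain f r where f: "f \<in> \<Gamma>" "r \<in> F" "\<phi> v = f r" using bspec[OF F(3) \<phi>[OF v]] by blast
      have "v = T f (\<psi> r)" using f F(2) \<psi> \<psi>\<phi>[OF v] by (auto simp: T_def subset_iff)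
      then show ?thesis using f by blast
    qed
    then show "\<exists>F. finite F \<and> F \<subseteq> V \<and> (\<forall>v\<in>V. \<exists>f\<in>T ` \<Gamma>. \<exists>r\<in>F. v = f r)"
      using F \<psi> by (intro exI[of _ "\<psi> ` F"]) auto
  qed (use simple in \<open>auto simp: insert_commute\<close>)
  then show ?thesis by blast
qed

section \<open>The lattices of the class S\<close>

lemma doubleton_edge_in:
  assumes "simple_graph V E" "{x, y} \<in> E"
  shows "x \<in> V" "y \<in> V"
  using assms by (auto simp: simple_graph_def doubleton_eq_iff)

section \<open>Planar lattices and their translation groups\<close>

definition translation_symmetry :: "(real^2) set \<Rightarrow> (real^2) set set \<Rightarrow> real^2 \<Rightarrow> bool" where
  "translation_symmetry V E t \<longleftrightarrow>
    (\<forall>v. v + t \<in> V \<longleftrightarrow> v \<in> V) \<and> (\<forall>u v. {u + t, v + t} \<in> E \<longleftrightarrow> {u, v} \<in> E)"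

lemma translation_symmetry_add:
  assumes "translation_symmetry V E s" "translation_symmetry V E t"
  shows "translation_symmetry V E (s + t)"
  using assms unfolding translation_symmetry_def by (simp add: add.assoc[symmetric])

lemma translation_symmetry_minus:
  assumes "translation_symmetry V E t"
  shows "translation_symmetry V E (- t)"
proof -
  have "(v - t) + t \<in> V \<longleftrightarrow> v - t \<in> V" "{(u - t) + t, (v - t) + t} \<in> E \<longleftrightarrow> {u - t, v - t} \<in> E" for u v
    using assms unfolding translation_symmetry_def by blast+
  then show ?thesis by (simp add: translation_symmetry_def)
qed

lemma translation_symmetry_multiple:
  assumes "translation_symmetry V E t"
  shows "translation_symmetry V E (of_int m *\<^sub>R t)"
proof -
  have nat: "translation_symmetry V E (real n *\<^sub>R t)" for n
  proof (induction n)
    case 0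
    then show ?case by (simp add: translation_symmetry_def)
  next
    case (Suc n)
    then show ?case using translation_symmetry_add[OF assms Suc] by (simp add: algebra_simps)
  qed
  show ?thesis
  proof (cases m rule: int_cases2)
    case (nonneg n)
    then show ?thesis using nat[of n] by simp
  next
    case (nonpos n)
    then show ?thesis using translation_symmetry_minus[OF nat[of n]] by simp
  qed
qed

text \<open>An injective map that carries a set onto itself also reflects membership; this is
  applied to vertices and, through images, to edges.\<close>

lemma preserved_by_translation_symmetry:
  assumes "preserved_by V E \<gamma> t"
  shows "translation_symmetry V E t"
proof -
  have inj: "inj (translate2 t)" by (simp add: inj_def translate2_def)
  have inj': "inj ((`) (translate2 t))" using inj_image_eq_iff[OF inj] by (auto intro: injI)
  have V: "translate2 t ` V = V" and E: "(\<lambda>e. translate2 t ` e) ` E = E"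
    using assms by (auto simp: preserved_by_def)
  have "v + t \<in> V \<longleftrightarrow> v \<in> V" for v
    using inj_image_mem_iff[OF inj, of v V] V by (simp add: translate2_def)
  moreover have "translate2 t ` e \<in> E \<longleftrightarrow> e \<in> E" for e
    using inj_image_mem_iff[OF inj', of e E] E by simp
  from this[of "{_, _}"] have "{u + t, v + t} \<in> E \<longleftrightarrow> {u, v} \<in> E" for u v
    by (simp add: translate2_def)
  ultimately show ?thesis by (simp add: translation_symmetry_def)
qed

text \<open>The group consists of the translations by integer combinations of the two periods. The
  height is a linear functional, so each translation shifts it by a constant.\<close>

lemma planar_lattice_periodic:
  assumes "planar_lattice V E"
  shows "\<exists>\<Gamma> h. periodic_lattice V E \<Gamma> h"
proof -
  have simple: "simple_graph V E" and lf: "locally_finite V E" and conn: "graph_connected V E"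
    using assms by (auto simp: planar_lattice_def)
  obtain \<gamma> a b where det: "a $ 1 * b $ 2 - a $ 2 * b $ 1 \<noteq> 0"
    and pres: "preserved_by V E \<gamma> a" "preserved_by V E \<gamma> b"
    and fin: "finite (V // {(x, y). x \<in> V \<and> y \<in> V \<and>
                   (\<exists>m n :: int. y = x + of_int m *\<^sub>R a + of_int n *\<^sub>R b)})" (is "finite (V // ?r)")
    using assms unfolding planar_lattice_def by blast
  define T where "T = {of_int m *\<^sub>R a + of_int n *\<^sub>R b | m n :: int. True}"
  \<comment> \<open>The determinant with \<open>b\<close>: it vanishes at \<open>b\<close>, and
    linear independence makes it nonzero at \<open>a\<close>, so \<open>a\<close> or
    \<open>- a\<close> ascends.\<close>
  define h where "h v = v $ 1 * b $ 2 - v $ 2 * b $ 1" for v :: "real^2"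
  have sym: "translation_symmetry V E t" if "t \<in> T" for t
    using that pres[THEN preserved_by_translation_symmetry] unfolding T_def
    by (auto intro!: translation_symmetry_add translation_symmetry_multiple)
  have TV: "v + t \<in> V \<longleftrightarrow> v \<in> V" and TE: "{u + t, v + t} \<in> E \<longleftrightarrow> {u, v} \<in> E" if "t \<in> T" for t u v
    using sym[OF that] by (auto simp: translation_symmetry_def)
  have T_add: "s + t \<in> T" if st: "s \<in> T" "t \<in> T" for s t
  proof -
    obtain m n m' n' :: int where "s = of_int m *\<^sub>R a + of_int n *\<^sub>R b" "t = of_int m' *\<^sub>R a + of_int n' *\<^sub>R b"
      using st by (auto simp: T_def)
    then have "s + t = of_int (m + m') *\<^sub>R a + of_int (n + n') *\<^sub>R b" by (simp add: algebra_simps)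
    then show ?thesis unfolding T_def by blast
  qed
  have T_minus: "- t \<in> T" if t: "t \<in> T" for t
  proof -
    obtain m n :: int where "t = of_int m *\<^sub>R a + of_int n *\<^sub>R b" using t by (auto simp: T_def)
    then have "- t = of_int (- m) *\<^sub>R a + of_int (- n) *\<^sub>R b" by simp
    then show ?thesis unfolding T_def by blast
  qed
  have "of_int 1 *\<^sub>R a + of_int 0 *\<^sub>R b \<in> T" unfolding T_def by blast
  then have aT: "a \<in> T" by simp
  have h_add: "h (v + t) = h v + h t" for v t by (simp add: h_def algebra_simps)
  have "periodic_lattice V E ((\<lambda>t v. v + t) ` T) h"
  proof
    fix u v assume "u \<in> V" "v \<in> V"
    then have "(u, v) \<in> (adj_rel E)\<^sup>*" using conn by (simp add: graph_connected_def)
    moreover have "adj_rel E = {(x, y). x \<in> V \<and> y \<in> V \<and> {x, y} \<in> E}"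
      using doubleton_edge_in[OF simple] by (auto simp: adj_rel_def)
    ultimately show "(u, v) \<in> {(x, y). x \<in> V \<and> y \<in> V \<and> {x, y} \<in> E}\<^sup>*" by simp
  next
    fix u assume u: "u \<in> V"
    have "finite ((\<lambda>v. {u, v}) ` {v \<in> V. {u, v} \<in> E})"
    proof (rule finite_subset)
      show "finite {e \<in> E. u \<in> e}" using lf u by (simp add: locally_finite_def)
    qed auto
    then show "finite {v \<in> V. {u, v} \<in> E}"
      by (rule finite_imageD) (auto simp: inj_on_def doubleton_eq_iff)
  next
    fix f assume "f \<in> (\<lambda>t v. v + t) ` T"
    then obtain t where t: "t \<in> T" "f = (\<lambda>v. v + t)" by blast
    show "bij_betw f V V" unfolding t(2)
    proof (rule bij_betw_byWitness[where f' = "\<lambda>v. v + - t"])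
      show "(\<lambda>v. v + t) ` V \<subseteq> V" using TV[OF t(1)] by blast
      show "(\<lambda>v. v + - t) ` V \<subseteq> V" using TV[OF T_minus[OF t(1)]] by blast
    qed auto
    show "\<exists>g\<in>(\<lambda>t v. v + t) ` T. \<forall>v\<in>V. g (f v) = v"
      by (rule bexI[OF _ imageI[OF T_minus[OF t(1)]]]) (simp add: t)
    show "\<exists>c. \<forall>v\<in>V. h (f v) = h v + c" using h_add by (auto simp: t)
    show "f v = v" if "f (f v) = v" for v
    proof -
      have "(2::real) *\<^sub>R t = 0" using that by (simp add: t scaleR_2 add.assoc)
      then show ?thesis by (simp add: t)
    qed
  next
    obtain t where t: "t \<in> T" "0 < h t"
    proof (cases "0 < h a")
      case False
      then have "0 < h (- a)" using det by (simp add: h_def)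
      then show ?thesis using that T_minus[OF aT] by blast
    qed (use that aT in blast)
    have "\<exists>c>0. \<forall>v\<in>V. h (v + t) = h v + c" using t(2) h_add by blast
    then show "\<exists>f\<in>(\<lambda>t v. v + t) ` T. \<exists>c>0. \<forall>v\<in>V. h (f v) = h v + c"
      by (rule bexI[of _ "\<lambda>v. v + t"]) (rule imageI[OF t(1)])
  next
    \<comment> \<open>One representative is chosen from each of the finitely many translation
      classes.\<close>
    let ?F = "(\<lambda>X. SOME x. x \<in> X) ` (V // ?r)"
    have some: "(SOME x. x \<in> ?r `` {v}) \<in> ?r `` {v}" if v: "v \<in> V" for v
    proof (rule someI)
      have "v = v + of_int 0 *\<^sub>R a + of_int 0 *\<^sub>R b" by simp
      then show "v \<in> ?r `` {v}" using v by blast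
    qed
    have "\<exists>f\<in>(\<lambda>t v. v + t) ` T. \<exists>r\<in>?F. v = f r" if v: "v \<in> V" for v
    proof -
      let ?x = "SOME x. x \<in> ?r `` {v}"
      have F: "?x \<in> ?F" using quotientI[OF v, of ?r] by blast
      obtain m n :: int where "?x = v + of_int m *\<^sub>R a + of_int n *\<^sub>R b" using some[OF v] by blast
      then have "v = ?x + - (of_int m *\<^sub>R a + of_int n *\<^sub>R b)" by (simp add: algebra_simps)
      then have "\<exists>r\<in>?F. v = r + - (of_int m *\<^sub>R a + of_int n *\<^sub>R b)" using F by (rule bexI)
      then show ?thesis
      proof (rule bexI[of _ "\<lambda>v. v + - (of_int m *\<^sub>R a + of_int n *\<^sub>R b)"])
        have "- (of_int m *\<^sub>R a + of_int n *\<^sub>R b) \<in> T" by (rule T_minus) (auto simp: T_def)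
        then show "(\<lambda>v. v + - (of_int m *\<^sub>R a + of_int n *\<^sub>R b)) \<in> (\<lambda>t v. v + t) ` T" by (rule imageI)
      qed
    qed
    moreover have "?F \<subseteq> V"
    proof
      fix x assume "x \<in> ?F"
      then obtain v where "v \<in> V" "x = (SOME x. x \<in> ?r `` {v})" by (auto simp: quotient_def)
      then show "x \<in> V" using some[of v] by simp
    qed
    ultimately show "\<exists>F. finite F \<and> F \<subseteq> V \<and> (\<forall>v\<in>V. \<exists>f\<in>(\<lambda>t v. v + t) ` T. \<exists>r\<in>F. v = f r)"
      using fin by (intro exI[of _ ?F]) auto
  next
    fix f g assume "f \<in> (\<lambda>t v. v + t) ` T" "g \<in> (\<lambda>t v. v + t) ` T"
    then obtain s t where st: "s \<in> T" "t \<in> T" "f = (\<lambda>v. v + s)" "g = (\<lambda>v. v + t)" by blast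
    show "\<exists>k\<in>(\<lambda>t v. v + t) ` T. \<forall>v\<in>V. k v = f (g v)"
      by (rule bexI[OF _ imageI[OF T_add[OF st(2,1)]]]) (simp add: st add.assoc)
    show "f v = g v" if "f u = g u" for u v using that by (simp add: st)
  qed (use simple TE in \<open>auto simp: insert_commute\<close>)
  then show ?thesis by blast
qed

section \<open>Translations of the hypercubic lattice and of its variant with diagonals\<close>

definition shift :: "nat \<Rightarrow> (nat \<Rightarrow> int) \<Rightarrow> int list \<Rightarrow> int list" where
  "shift d t x = map (\<lambda>i. x ! i + t i) [0..<d]"

lemma shift_nth [simp]: "i < d \<Longrightarrow> shift d t x ! i = x ! i + t i"
  by (simp add: shift_def)

lemma shift_in [simp]: "shift d t x \<in> Zd_V d"
  by (simp add: shift_def Zd_V_def)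

lemma Zd_V_eqI: "x \<in> Zd_V d \<Longrightarrow> y \<in> Zd_V d \<Longrightarrow> (\<And>i. i < d \<Longrightarrow> x ! i = y ! i) \<Longrightarrow> x = y"
  by (simp add: Zd_V_def list_eq_iff_nth_eq)

lemma shift_shift: "shift d s (shift d t x) = shift d (\<lambda>i. t i + s i) x"
  by (rule Zd_V_eqI[of _ d]) auto

lemma shift_zero: "x \<in> Zd_V d \<Longrightarrow> (\<And>i. i < d \<Longrightarrow> t i = 0) \<Longrightarrow> shift d t x = x"
  by (rule Zd_V_eqI[of _ d]) auto

lemma Zd_edge_in: "x \<in> Zd_V d \<Longrightarrow> y \<in> Zd_V d \<Longrightarrow> i < d \<Longrightarrow> \<bar>y ! i - x ! i\<bar> = 1 \<Longrightarrow>
    (\<And>j. j < d \<Longrightarrow> j \<noteq> i \<Longrightarrow> y ! j = x ! j) \<Longrightarrow> {x, y} \<in> Zd_E d"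
  unfolding Zd_E_def by blast

lemma Zd_E_cases:
  assumes "e \<in> Zd_E d"
  obtains x y i where "e = {x, y}" "x \<in> Zd_V d" "y \<in> Zd_V d" "i < d" "\<bar>y ! i - x ! i\<bar> = 1"
    "\<And>j. j < d \<Longrightarrow> j \<noteq> i \<Longrightarrow> y ! j = x ! j"
  using assms unfolding Zd_E_def by blast

lemma Td_E_cases:
  assumes "e \<in> Td_E d"
  obtains "e \<in> Zd_E d"
  | x y i j where "e = {x, y}" "x \<in> Zd_V d" "y \<in> Zd_V d" "i < d" "j < d" "i \<noteq> j"
    "y ! i - x ! i = 1" "y ! j - x ! j = 1"
    "\<And>k. k < d \<Longrightarrow> k \<noteq> i \<Longrightarrow> k \<noteq> j \<Longrightarrow> y ! k = x ! k"
  using assms unfolding Td_E_def by blast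

lemma shift_Zd_E: "e \<in> Zd_E d \<Longrightarrow> shift d t ` e \<in> Zd_E d"
  by (erule Zd_E_cases) (auto intro!: Zd_edge_in)

lemma shift_Td_E: "e \<in> Td_E d \<Longrightarrow> shift d t ` e \<in> Td_E d"
proof (erule Td_E_cases)
  assume "e \<in> Zd_E d"
  then show ?thesis using shift_Zd_E by (simp add: Td_E_def)
next
  fix x y i j assume *: "e = {x, y}" "x \<in> Zd_V d" "y \<in> Zd_V d" "i < d" "j < d" "i \<noteq> j"
    "y ! i - x ! i = 1" "y ! j - x ! j = 1"
    "\<And>k. k < d \<Longrightarrow> k \<noteq> i \<Longrightarrow> k \<noteq> j \<Longrightarrow> y ! k = x ! k"
  have "\<exists>i<d. \<exists>j<d. i \<noteq> j \<and> shift d t y ! i - shift d t x ! i = 1 \<and> shift d t y ! j - shift d t x ! j = 1 \<and>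
      (\<forall>k<d. k \<noteq> i \<and> k \<noteq> j \<longrightarrow> shift d t y ! k = shift d t x ! k)"
    by (rule exI[of _ i], rule conjI[OF *(4)], rule exI[of _ j]) (use * in auto)
  then have "{shift d t x, shift d t y} \<in> Td_E d" unfolding Td_E_def using shift_in by blast
  then show ?thesis using *(1) by simp
qed

lemma Zd_E_bounded:
  assumes "{x, y} \<in> Zd_E d" "i < d"
  shows "\<bar>y ! i - x ! i\<bar> \<le> 1"
  using assms(1)
proof (rule Zd_E_cases)
  fix u v k assume *: "{x, y} = {u, v}" "k < d" "\<bar>v ! k - u ! k\<bar> = 1" "\<And>j. j < d \<Longrightarrow> j \<noteq> k \<Longrightarrow> v ! j = u ! j"
  have "\<bar>v ! i - u ! i\<bar> \<le> 1" using * assms(2) by (cases "i = k") auto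
  then show ?thesis using *(1) by (auto simp: doubleton_eq_iff)
qed

lemma Td_E_bounded:
  assumes "{x, y} \<in> Td_E d" "i < d"
  shows "\<bar>y ! i - x ! i\<bar> \<le> 1"
  using assms(1)
proof (rule Td_E_cases)
  assume "{x, y} \<in> Zd_E d"
  then show ?thesis using Zd_E_bounded assms(2) by blast
next
  fix u v k l assume *: "{x, y} = {u, v}" "v ! k - u ! k = 1" "v ! l - u ! l = 1"
    "\<And>j. j < d \<Longrightarrow> j \<noteq> k \<Longrightarrow> j \<noteq> l \<Longrightarrow> v ! j = u ! j"
  have "\<bar>v ! i - u ! i\<bar> \<le> 1" using * assms(2) by (cases "i = k \<or> i = l") auto
  then show ?thesis using *(1) by (auto simp: doubleton_eq_iff)
qed

lemma simple_Zd: "simple_graph (Zd_V d) (Zd_E d)"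
proof -
  have "\<exists>x y. x \<in> Zd_V d \<and> y \<in> Zd_V d \<and> x \<noteq> y \<and> e = {x, y}" if "e \<in> Zd_E d" for e
    using that
  proof (rule Zd_E_cases)
    fix x y i assume "e = {x, y}" "x \<in> Zd_V d" "y \<in> Zd_V d" "\<bar>y ! i - x ! i\<bar> = 1"
    then show ?thesis by (intro exI[of _ x] exI[of _ y]) auto
  qed
  then show ?thesis unfolding simple_graph_def by blast
qed

lemma simple_Td: "simple_graph (Zd_V d) (Td_E d)"
proof -
  have "\<exists>x y. x \<in> Zd_V d \<and> y \<in> Zd_V d \<and> x \<noteq> y \<and> e = {x, y}" if "e \<in> Td_E d" for e
    using that
  proof (rule Td_E_cases)
    assume "e \<in> Zd_E d"
    then show ?thesis using simple_Zd unfolding simple_graph_def by blast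
  next
    fix x y i assume "e = {x, y}" "x \<in> Zd_V d" "y \<in> Zd_V d" "y ! i - x ! i = 1"
    then show ?thesis by (intro exI[of _ x] exI[of _ y]) auto
  qed
  then show ?thesis unfolding simple_graph_def by blast
qed

text \<open>Induction on the sum of the absolute values of the coordinates: moving a nonzero
  coordinate one step towards 0 decreases it.\<close>

lemma Zd_reach_origin:
  assumes "x \<in> Zd_V d"
  shows "(replicate d 0, x) \<in> {(x, y). x \<in> Zd_V d \<and> y \<in> Zd_V d \<and> {x, y} \<in> Zd_E d}\<^sup>*"
  using assms
proof (induction "\<Sum>i<d. nat \<bar>x ! i\<bar>" arbitrary: x rule: less_induct)
  case less
  show ?case
  proof (cases "\<exists>i<d. x ! i \<noteq> 0")
    case False
    then have "x = replicate d 0" using less.prems by (intro Zd_V_eqI[of _ d]) (auto simp: Zd_V_def)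
    then show ?thesis by simp
  next
    case True
    then obtain i where i: "i < d" "x ! i \<noteq> 0" by blast
    define y where "y = x[i := x ! i - sgn (x ! i)]"
    have len: "length x = d" using less.prems by (simp add: Zd_V_def)
    have y: "y \<in> Zd_V d" using len by (simp add: y_def Zd_V_def)
    have nth: "y ! j = (if j = i then x ! i - sgn (x ! i) else x ! j)" if "j < d" for j
      using that len by (simp add: y_def nth_list_update)
    have "(\<Sum>j<d. nat \<bar>y ! j\<bar>) < (\<Sum>j<d. nat \<bar>x ! j\<bar>)"
    proof (rule sum_strict_mono_ex1)
      show "\<forall>j\<in>{..<d}. nat \<bar>y ! j\<bar> \<le> nat \<bar>x ! j\<bar>"
        using nth i by (auto simp: sgn_if)
      show "\<exists>j\<in>{..<d}. nat \<bar>y ! j\<bar> < nat \<bar>x ! j\<bar>"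
        using nth i by (intro bexI[of _ i]) (auto simp: sgn_if)
    qed simp
    then have "(replicate d 0, y) \<in> {(x, y). x \<in> Zd_V d \<and> y \<in> Zd_V d \<and> {x, y} \<in> Zd_E d}\<^sup>*"
      using less.hyps y by blast
    moreover have "{y, x} \<in> Zd_E d"
      using i nth by (intro Zd_edge_in[OF y less.prems i(1)]) (auto simp: sgn_if)
    ultimately show ?thesis using y less.prems by (auto intro: rtrancl_into_rtrancl)
  qed
qed

text \<open>Covers both lattices at once: the nearest-neighbour edges give connectedness, the
  bounded range gives local finiteness, and all shifts together act transitively. Coordinate 0 is
  the height.\<close>

lemma shift_invariant_periodic:
  assumes d: "0 < d" and simple: "simple_graph (Zd_V d) E" and sub: "Zd_E d \<subseteq> E"
    and inv: "\<And>e t. e \<in> E \<Longrightarrow> shift d t ` e \<in> E"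
    and bounded: "\<And>x y i. {x, y} \<in> E \<Longrightarrow> i < d \<Longrightarrow> \<bar>y ! i - x ! i\<bar> \<le> 1"
  shows "periodic_lattice (Zd_V d) E (range (shift d)) (\<lambda>x. of_int (x ! 0))"
proof
  let ?R = "{(x, y). x \<in> Zd_V d \<and> y \<in> Zd_V d \<and> {x, y} \<in> E}"
  fix u v assume uv: "u \<in> Zd_V d" "v \<in> Zd_V d"
  have reach: "(replicate d 0, x) \<in> ?R\<^sup>*" if "x \<in> Zd_V d" for x
    using Zd_reach_origin[OF that] rtrancl_mono[of "{(x, y). x \<in> Zd_V d \<and> y \<in> Zd_V d \<and> {x, y} \<in> Zd_E d}" ?R] sub
    by blast
  have "sym (?R\<^sup>*)" by (rule sym_rtrancl) (auto simp: sym_def insert_commute)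
  then have "(u, replicate d 0) \<in> ?R\<^sup>*" using reach[OF uv(1)] by (rule symD)
  then show "(u, v) \<in> ?R\<^sup>*" using reach[OF uv(2)] by (rule rtrancl_trans)
next
  fix u assume "u \<in> Zd_V d"
  \<comment> \<open>A crude finite set containing every entry of every neighbour of
    \<open>u\<close>.\<close>
  let ?S = "\<Union>c\<in>set u. {c - 1..c + 1}"
  have "{v \<in> Zd_V d. {u, v} \<in> E} \<subseteq> {v. set v \<subseteq> ?S \<and> length v = d}"
  proof
    fix v assume v: "v \<in> {v \<in> Zd_V d. {u, v} \<in> E}"
    have "x \<in> ?S" if x: "x \<in> set v" for x
    proof -
      obtain i where i: "i < d" "x = v ! i" using x v by (auto simp: in_set_conv_nth Zd_V_def)
      then have "u ! i \<in> set u" using \<open>u \<in> Zd_V d\<close> by (simp add: Zd_V_def)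
      moreover have "\<bar>x - u ! i\<bar> \<le> 1" using bounded[of u v i] v i by simp
      ultimately show ?thesis by (intro UN_I[of "u ! i"]) auto
    qed
    then show "v \<in> {v. set v \<subseteq> ?S \<and> length v = d}" using v by (auto simp: Zd_V_def)
  qed
  then show "finite {v \<in> Zd_V d. {u, v} \<in> E}"
    by (rule finite_subset) (intro finite_lists_length_eq, simp)
next
  fix f assume "f \<in> range (shift d)"
  then obtain t where t: "f = shift d t" by blast
  let ?s = "\<lambda>i. - t i"
  have inv1: "shift d ?s (shift d t x) = x" and inv2: "shift d t (shift d ?s x) = x" if "x \<in> Zd_V d" for x
    using that by (auto simp: shift_shift intro: shift_zero)
  show "bij_betw f (Zd_V d) (Zd_V d)" unfolding t
    by (rule bij_betw_byWitness[where f' = "shift d ?s"]) (use inv1 inv2 in auto)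
  show "{f u, f v} \<in> E \<longleftrightarrow> {u, v} \<in> E" if "u \<in> Zd_V d" "v \<in> Zd_V d" for u v
  proof
    assume "{f u, f v} \<in> E"
    from inv[OF this, of ?s] show "{u, v} \<in> E" using inv1 that by (simp add: t)
  next
    assume "{u, v} \<in> E"
    from inv[OF this, of t] show "{f u, f v} \<in> E" by (simp add: t)
  qed
  show "\<exists>g\<in>range (shift d). \<forall>v\<in>Zd_V d. g (f v) = v" using inv1 t by blast
  show "\<exists>c. \<forall>v\<in>Zd_V d. real_of_int (f v ! 0) = real_of_int (v ! 0) + c"
    using d by (intro exI[of _ "of_int (t 0)"]) (simp add: t)
  show "f v = v" if v: "v \<in> Zd_V d" "f (f v) = v" for v
  proof -
    have "t i = 0" if "i < d" for i
    proof -
      have "f (f v) ! i = v ! i + 2 * t i" using that by (simp add: t)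
      then show ?thesis using v(2) by simp
    qed
    then show ?thesis unfolding t by (rule shift_zero[OF v(1)])
  qed
next
  show "\<exists>f\<in>range (shift d). \<exists>c>0. \<forall>v\<in>Zd_V d. real_of_int (f v ! 0) = real_of_int (v ! 0) + c"
    using d by (intro bexI[of _ "shift d (\<lambda>_. 1)"] exI[of _ 1]) auto
next
  have "v = shift d ((!) v) (replicate d 0)" if "v \<in> Zd_V d" for v
    using that by (intro Zd_V_eqI[of _ d]) auto
  then have "\<forall>v\<in>Zd_V d. \<exists>f\<in>range (shift d). \<exists>r\<in>{replicate d 0}. v = f r" by blast
  then show "\<exists>F. finite F \<and> F \<subseteq> Zd_V d \<and> (\<forall>v\<in>Zd_V d. \<exists>f\<in>range (shift d). \<exists>r\<in>F. v = f r)"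
    by (intro exI[of _ "{replicate d 0}"]) (simp add: Zd_V_def)
next
  fix f g assume "f \<in> range (shift d)" "g \<in> range (shift d)"
  then obtain s t where st: "f = shift d s" "g = shift d t" by blast
  show "\<exists>k\<in>range (shift d). \<forall>v\<in>Zd_V d. k v = f (g v)" by (auto simp: st shift_shift)
  show "f v = g v" if "f u = g u" for u v
  proof (rule Zd_V_eqI[of _ d])
    fix i assume i: "i < d"
    have "f u ! i = g u ! i" using that by simp
    then show "f v ! i = g v ! i" using i by (simp add: st)
  qed (simp_all add: st)
qed (use simple in \<open>auto simp: insert_commute\<close>)

lemma in_class_S_periodic:
  assumes "in_class_S V E"
  shows "\<exists>\<Gamma> h. periodic_lattice V E \<Gamma> h"
proof -
  have simple: "simple_graph V E" using assms by (simp add: in_class_S_def)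
  have Zd: "periodic_lattice (Zd_V d) (Zd_E d) (range (shift d)) (\<lambda>x. of_int (x ! 0))" if "2 \<le> d" for d
    using that by (intro shift_invariant_periodic simple_Zd shift_Zd_E Zd_E_bounded) auto
  have Td: "periodic_lattice (Zd_V d) (Td_E d) (range (shift d)) (\<lambda>x. of_int (x ! 0))" if "2 \<le> d" for d
    using that by (intro shift_invariant_periodic simple_Td shift_Td_E Td_E_bounded) (auto simp: Td_E_def)
  consider V' E' and f :: "'a \<Rightarrow> real^2" where "planar_lattice V' E'" "graph_iso f V E V' E'"
    | d f where "2 \<le> d" "graph_iso f V E (Zd_V d) (Zd_E d)"
    | d f where "2 \<le> d" "graph_iso f V E (Zd_V d) (Td_E d)"
    using assms unfolding in_class_S_def by blast
  then show ?thesis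
  proof cases
    case 1
    then show ?thesis using planar_lattice_periodic periodic_lattice_iso[OF _ simple] by blast
  next
    case 2
    then show ?thesis using Zd periodic_lattice_iso[OF _ simple] by blast
  next
    case 3
    then show ?thesis using Td periodic_lattice_iso[OF _ simple] by blast
  qed
qed

theorem theorem10p1:
  fixes V :: "'v set" and E :: "'v set set" and v0 :: 'v
  assumes "in_class_S V E" and "v0 \<in> V"
  shows "continuous_on {0<..<1} (bond_c E v0) \<and> continuous_on {0<..<1} (site_c V E v0)"
proof -
  obtain \<Gamma> h where "periodic_lattice V E \<Gamma> h" using in_class_S_periodic[OF assms(1)] by blast
  then interpret periodic_lattice V E \<Gamma> h .
  show ?thesis using continuous_bond_c continuous_site_c assms(2) by blast
qed

end
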